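(* Let $1<q<\infty$ and $q+1<p\le r<\infty$. There is a constant $c$, depending only on $p,q,r,n$, such that for every weight $w$ on $\mathbb{R}^n$ and every sequence $f=\{f_i\}_{i\ge1}$ of locally integrable functions on $\mathbb{R}^n$, $$\|\overline M_qf\|_{L^p(w)}\le c\,\|w\|_{(A_p)^{\frac{1}{p-1}}(A_r)^{\frac1q-\frac{1}{p-1}}}\Big(\int_{\mathbb{R}^n}\|f(x)\|_{\ell^q}^p\,w(x)\,dx\Big)^{1/p}.$$
   Context: The vector-valued maximal operator is $$\overline M_qf(x)=\Big(\sum_{i=1}^\infty Mf_i(x)^q\Big)^{1/q},$$ where $M$ is the Hardy-Littlewood maximal operator, $Mg(x)=\sup_{Q\ni x}\frac{1}{|Q|}\int_Q|g|$ (supremum over cubes containing $x$), and $\|f(x)\|_{\ell^q}=(\sum_{i}|f_i(x)|^q)^{1/q}$. A weight is a non-negative locally integrable function $w$ on $\mathbb{R}^n$, and $\|g\|_{L^p(w)}=(\int_{\mathbb{R}^n}|g|^p w\,dx)^{1/p}$. For a cube $Q\subset\mathbb{R}^n$ and $1<p<\infty$, $$A_p(w;Q)=\Big(\frac{1}{|Q|}\int_Q w\Big)\Big(\frac{1}{|Q|}\int_Q w^{-\frac{1}{p-1}}\Big)^{p-1}.$$ For exponents $\alpha,\beta$ and $1<p,r<\infty$, $$\|w\|_{(A_p)^{\alpha}(A_r)^{\beta}}=\sup_{Q\subset\mathbb{R}^n}A_p(w;Q)^{\alpha}A_r(w;Q)^{\beta},$$ where a single supremum is taken over all cubes $Q\subset\mathbb{R}^n$.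 The inequality is understood to have content only when the right-hand side is finite. *)

theory Defs
  imports "HOL-Analysis.Analysis"
begin

text \<open>
  All quantities are taken in \<open>[0,\<infinity>]\<close>. The power below uses the usual conventions at the
  end points, in particular \<open>0\<close> to a negative power is \<open>\<infinity>\<close>; products are those of
  \<^typ>\<open>ennreal\<close>, so \<open>0 * \<infinity> = 0\<close>.
\<close>

definition epowr :: "ennreal \<Rightarrow> real \<Rightarrow> ennreal"  (infixr \<open>epowr\<close> 80) where
  "x epowr a =
     (if a = 0 then 1
      else if x = 0 then (if a > 0 then 0 else \<infinity>)
      else if x = \<infinity> then (if a > 0 then \<infinity> else 0)
      else ennreal (enn2real x powr a))"

text \<open>Cubes have sides parallel to the axes, and are closed and nondegenerate.\<close>

definition cubes :: "(real ^ 'n) set set" where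
  "cubes = {cbox a (\<chi> i. a $ i + l) | a l. l > 0}"

definition average :: "(real ^ 'n) set \<Rightarrow> (real ^ 'n \<Rightarrow> ennreal) \<Rightarrow> ennreal" where
  "average Q h = (\<integral>\<^sup>+ x \<in> Q. h x \<partial>lebesgue) / emeasure lebesgue Q"

definition locally_integrable :: "(real ^ 'n \<Rightarrow> real) \<Rightarrow> bool" where
  "locally_integrable g \<longleftrightarrow> (\<forall>K. compact K \<longrightarrow> set_integrable lebesgue K g)"

definition weight :: "(real ^ 'n \<Rightarrow> real) \<Rightarrow> bool" where
  "weight w \<longleftrightarrow> (\<forall>x. 0 \<le> w x) \<and> locally_integrable w"

definition maximal :: "(real ^ 'n \<Rightarrow> real) \<Rightarrow> real ^ 'n \<Rightarrow> ennreal" where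
  "maximal g x = (SUP Q \<in> {Q \<in> cubes. x \<in> Q}. average Q (\<lambda>y. ennreal \<bar>g y\<bar>))"

definition vector_maximal :: "real \<Rightarrow> (nat \<Rightarrow> real ^ 'n \<Rightarrow> real) \<Rightarrow> real ^ 'n \<Rightarrow> ennreal" where
  "vector_maximal q f x = (\<Sum>i. maximal (f i) x epowr q) epowr (1 / q)"

definition lq_norm :: "real \<Rightarrow> (nat \<Rightarrow> real) \<Rightarrow> ennreal" where
  "lq_norm q a = (\<Sum>i. ennreal \<bar>a i\<bar> epowr q) epowr (1 / q)"

definition weighted_Lp_norm ::
    "real \<Rightarrow> (real ^ 'n \<Rightarrow> real) \<Rightarrow> (real ^ 'n \<Rightarrow> ennreal) \<Rightarrow> ennreal" where
  "weighted_Lp_norm p w g = (\<integral>\<^sup>+ x. g x epowr p * ennreal (w x) \<partial>lebesgue) epowr (1 / p)"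

definition Ap_cube :: "real \<Rightarrow> (real ^ 'n \<Rightarrow> real) \<Rightarrow> (real ^ 'n) set \<Rightarrow> ennreal" where
  "Ap_cube p w Q =
     average Q (\<lambda>x. ennreal (w x)) *
     average Q (\<lambda>x. ennreal (w x) epowr (- 1 / (p - 1))) epowr (p - 1)"

text \<open>
  If \<open>w\<close> vanishes a.e. on a cube without vanishing a.e., a larger cube makes the supremum
  infinite, so the value \<open>0 * \<infinity> = 0\<close> on the small cube is harmless. An infinite constant has to be
  excluded explicitly wherever it multiplies a possibly vanishing norm.
\<close>

definition mixed_Ap_Ar :: "real \<Rightarrow> real \<Rightarrow> real \<Rightarrow> real \<Rightarrow> (real ^ 'n \<Rightarrow> real) \<Rightarrow> ennreal" where
  "mixed_Ap_Ar p \<alpha> r \<beta> w = (SUP Q \<in> cubes. Ap_cube p w Q epowr \<alpha> * Ap_cube r w Q epowr \<beta>)"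

end

theory Submission
  imports Defs
begin

text \<open>
  Let \<open>\<sigma> = w\<^sup>-\<^sup>1\<^sup>/\<^sup>(\<^sup>p\<^sup>-\<^sup>1\<^sup>)\<close> and \<open>g = \<parallel>f\<parallel>\<close>, the pointwise \<open>\<ell>\<^sup>q\<close> norm. The proof reduces the maximal operator to
  finitely many dyadic grids, dominates the dyadic operator by a sparse sum, and bounds the sparse
  sum in a way that uses both \<open>A\<^sub>p\<close> and \<open>A\<^sub>r\<close> on the same cube.

  Sparse domination. In a dyadic grid with finitely many generations, restart from a cube \<open>Q\<close>
  at the first descendants on which the \<open>\<ell>\<^sup>q\<close> norm of the maximal functions started at \<open>Q\<close> exceeds
  \<open>A\<close> times the average of \<open>g\<close> over \<open>Q\<close>. Up to the constant \<open>A\<^sup>q\<close>, the \<open>q\<close>-th power of the vector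
  maximal function is then at most the sum of the \<open>q\<close>-th powers of the averages of \<open>g\<close> over the
  restart (principal) cubes containing the point (\<open>sparse_domination\<close>). A weak type \<open>(1,1)\<close> estimate for
  the vector maximal function, obtained from the \<open>L\<^sup>q\<close> bound by stopping the averages where that of
  \<open>g\<close> becomes large, shows that at least half of each principal cube is not covered by later ones
  (\<open>principal_half\<close>).

  Weighted bound. Pair the sparse sum with \<open>\<phi> w\<close> and write \<open>g = h \<sigma>\<close>. A principal cube \<open>Q\<close>
  contributes \<open>\<langle>\<sigma>\<rangle>\<^sup>q \<langle>w\<rangle>\<close> times averages of \<open>h\<close> and \<open>\<phi>\<close> with respect to the measures \<open>\<sigma>\<close> and \<open>w\<close>. With
  \<open>\<gamma> = 1 - q/(p-1)\<close>, the factor \<open>\<langle>\<sigma>\<rangle>\<^sup>q \<langle>w\<rangle>\<close> equals \<open>A\<^sub>p(Q)\<close> to the power \<open>q/(p-1)\<close> times \<open>A\<^sub>r(Q)\<close> to the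
  power \<open>\<gamma>\<close>, divided by the average of \<open>\<nu> = w\<^sup>-\<^sup>1\<^sup>/\<^sup>(\<^sup>r\<^sup>-\<^sup>1\<^sup>)\<close> to the power \<open>(r-1)\<gamma>\<close>. The first two
  factors are at most \<open>K\<^sup>q\<close>, \<open>K\<close> being the mixed constant. By Jensen's inequality on the uncovered half
  of \<open>Q\<close>, the remaining negative power of an average is at most a constant times \<open>|Q|\<^sup>-\<^sup>1\<close> times the
  integral of \<open>w\<^sup>\<gamma>\<close> over that half (\<open>jensen_good_part\<close>). These halves are disjoint, so the sum becomes a single
  integral of maximal functions of \<open>h\<close> and \<open>\<phi>\<close> against \<open>w\<^sup>\<gamma>\<close>. The identity
  \<open>w\<^sup>\<gamma> = \<sigma>\<^sup>q\<^sup>/\<^sup>p w\<^sup>1\<^sup>-\<^sup>q\<^sup>/\<^sup>p\<close>, Hoelder's inequality and Doob's inequality for the measures \<open>\<sigma>\<close> and \<open>w\<close>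
  finish the estimate (\<open>dual_form\<close>). The test function \<open>\<phi>\<close> is a truncated power of the vector maximal
  function itself, which turns the bilinear estimate into a norm inequality (\<open>dyadic_bound\<close>).

  Passage to all cubes. Every cube of moderate size lies in a cell of comparable size of one of
  \<open>2\<^sup>n\<close> translated grids (\<open>one_third_trick\<close>). The grids depend on the range of sizes, and Fatou's lemma
  removes the truncation (\<open>maximal_bound\<close>). Finiteness of \<open>K\<close> forces a weight to vanish almost everywhere or almost
  nowhere (\<open>weight_zero_or_positive_AE\<close>), and in the second case it may be changed on a null set
  to be positive everywhere.
\<close>

section \<open>Powers and integral inequalities in the extended half-line\<close>

lemma epowr_zero_exp [simp]: "x epowr 0 = 1"
  by (simp add: epowr_def)

lemma zero_epowr [simp]: "0 < a \<Longrightarrow> 0 epowr a = 0"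
  by (simp add: epowr_def)

lemma top_epowr [simp]: "0 < a \<Longrightarrow> \<infinity> epowr a = \<infinity>" "0 < a \<Longrightarrow> top epowr a = top"
  by (simp_all add: epowr_def)

lemma epowr_ennreal: "0 < x \<Longrightarrow> ennreal x epowr a = ennreal (x powr a)"
  by (auto simp: epowr_def)

lemma epowr_ennreal_pos: "0 \<le> x \<Longrightarrow> 0 < a \<Longrightarrow> ennreal x epowr a = ennreal (x powr a)"
  by (cases "x = 0") (auto simp: epowr_ennreal)

lemma one_epowr [simp]: "1 epowr a = 1"
  using epowr_ennreal[of 1 a] by simp

text \<open>The three ranges on which \<open>epowr\<close> is given by different formulas.\<close>

lemma ennreal_cases_pos [case_names zero pos top]:
  fixes x :: ennreal
  obtains "x = 0" | r where "x = ennreal r" "0 < r" | "x = top"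
proof (cases x rule: ennreal_cases)
  case (real r)
  then show ?thesis using that by (cases "r = 0") auto
qed (use that in auto)

lemma epowr_one [simp]: "x epowr 1 = x"
  by (cases x rule: ennreal_cases_pos) (auto simp: epowr_ennreal)

lemma epowr_pos_iff: "0 < a \<Longrightarrow> x epowr a = 0 \<longleftrightarrow> x = 0"
  by (cases x rule: ennreal_cases_pos) (auto simp: epowr_ennreal)

lemma epowr_top_iff: "0 < a \<Longrightarrow> x epowr a = top \<longleftrightarrow> x = top"
  by (cases x rule: ennreal_cases_pos) (auto simp: epowr_ennreal)

lemma epowr_less_top: "0 < a \<Longrightarrow> x < top \<Longrightarrow> x epowr a < top"
  by (cases x rule: ennreal_cases_pos) (auto simp: epowr_ennreal)

lemma epowr_mult: "0 \<le> a \<Longrightarrow> (x * y) epowr a = x epowr a * y epowr a"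
proof (cases "a = 0")
  case False
  assume "0 \<le> a"
  with False have a: "0 < a" by simp
  show ?thesis
  proof (cases x rule: ennreal_cases_pos)
    case (pos r)
    show ?thesis
      by (cases y rule: ennreal_cases_pos)
        (use a pos in \<open>auto simp: epowr_ennreal ennreal_mult[symmetric] powr_mult ennreal_mult_top ennreal_top_mult\<close>)
  next
    case top
    then show ?thesis
      by (cases y rule: ennreal_cases_pos)
        (use a in \<open>auto simp: epowr_ennreal ennreal_top_mult\<close>)
  qed (use a in auto)
qed auto

lemma epowr_epowr: "(x epowr a) epowr b = x epowr (a * b)"
proof (cases x rule: ennreal_cases_pos)
  case (pos r)
  then show ?thesis by (simp add: epowr_ennreal powr_powr)
qed (auto simp: epowr_def zero_less_mult_iff mult_less_0_iff not_less)

lemma epowr_add: "0 \<le> a \<Longrightarrow> 0 \<le> b \<Longrightarrow> x epowr (a + b) = x epowr a * x epowr b"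
proof (cases x rule: ennreal_cases_pos)
  case (pos r)
  then show ?thesis by (simp add: epowr_ennreal powr_add ennreal_mult)
qed (auto simp: epowr_def)

text \<open>Away from the end points the exponents may have any sign.\<close>

lemma epowr_add_finite: "0 < x \<Longrightarrow> x < top \<Longrightarrow> x epowr (a + b) = x epowr a * x epowr b"
  by (cases x rule: ennreal_cases_pos) (auto simp: epowr_ennreal powr_add ennreal_mult)

lemma epowr_finite_pos: "0 < x \<Longrightarrow> x < top \<Longrightarrow> 0 < x epowr a \<and> x epowr a < top"
  by (cases x rule: ennreal_cases_pos) (auto simp: epowr_ennreal)

lemma epowr_mono: "0 \<le> a \<Longrightarrow> x \<le> y \<Longrightarrow> x epowr a \<le> y epowr a"
proof (cases "a = 0")
  case False
  assume a: "0 \<le> a" and xy: "x \<le> y"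
  show ?thesis
  proof (cases y rule: ennreal_cases_pos)
    case (pos r)
    then show ?thesis using a xy False
      by (cases x rule: ennreal_cases_pos)
        (auto simp: epowr_ennreal top_unique powr_mono2)
  next
    case top then show ?thesis using a False by auto
  qed (use a xy False in auto)
qed auto

text \<open>Raising to a positive power is an order isomorphism of \<open>[0,\<infinity>]\<close>; for this reason it commutes with suprema.\<close>

lemma epowr_le_iff: "0 < a \<Longrightarrow> x epowr a \<le> y \<longleftrightarrow> x \<le> y epowr (1 / a)"
proof
  assume a: "0 < a"
  show "x \<le> y epowr (1 / a)" if "x epowr a \<le> y"
    using epowr_mono[OF _ that, of "1 / a"] a by (simp add: epowr_epowr)
  show "x epowr a \<le> y" if "x \<le> y epowr (1 / a)"
    using epowr_mono[OF _ that, of a] a by (simp add: epowr_epowr)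
qed

lemma SUP_epowr: "0 < a \<Longrightarrow> (SUP i\<in>I. f i) epowr a = (SUP i\<in>I. f i epowr a)"
proof (rule order_antisym)
  assume a: "0 < a"
  have "f i \<le> (SUP i\<in>I. f i epowr a) epowr (1 / a)" if "i \<in> I" for i
    using SUP_upper[OF that, of "\<lambda>i. f i epowr a"] a by (simp add: epowr_le_iff)
  with a show "(SUP i\<in>I. f i) epowr a \<le> (SUP i\<in>I. f i epowr a)"
    by (auto simp: epowr_le_iff intro!: SUP_least)
qed (auto intro!: SUP_least epowr_mono SUP_upper)

lemma borel_measurable_epowr [measurable]:
  assumes [measurable]: "f \<in> borel_measurable M"
  shows "(\<lambda>x. f x epowr a) \<in> borel_measurable M"
  unfolding epowr_def by measurable

lemma max_epowr_le: "0 \<le> a \<Longrightarrow> (max x y) epowr a \<le> x epowr a + y epowr a"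
  by (auto simp: max_def)

text \<open>The crude bound by the cardinality times the largest summand; the sum will run over the finite family of translated grids.\<close>

lemma sum_epowr_le:
  assumes "finite I" "1 \<le> p"
  shows "(\<Sum>i\<in>I. f i) epowr p \<le> of_nat (card I) epowr p * (\<Sum>i\<in>I. f i epowr p)"
proof (cases "I = {}")
  case False
  define m where "m = Max (f ` I)"
  have "m \<in> f ` I"
    using assms False unfolding m_def by (intro Max_in) auto
  then obtain j where j: "j \<in> I" "m = f j" by blast
  have "(\<Sum>i\<in>I. f i) \<le> of_nat (card I) * m"
    using assms by (intro sum_bounded_above) (auto simp: m_def)
  then have "(\<Sum>i\<in>I. f i) epowr p \<le> of_nat (card I) epowr p * m epowr p"
    using epowr_mono[of p] epowr_mult[of p] assms by (metis order_trans zero_le_one)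
  also have "m epowr p \<le> (\<Sum>i\<in>I. f i epowr p)"
    unfolding j(2) using j(1) assms by (intro member_le_sum) auto
  finally show ?thesis by (simp add: mult_left_mono)
qed (use assms in auto)

text \<open>How a norm inequality is extracted from Hoelder's inequality: the factor \<open>x epowr (1 - 1 / p)\<close> on the right is
  cancelled, which is legitimate only because \<open>x\<close> is finite.\<close>

lemma absorb_power:
  assumes p: "1 < p" and le: "x \<le> c * a epowr (1 / p) * x epowr (1 - 1 / p)" and fin: "x < top"
  shows "x \<le> c epowr p * a"
proof (cases "x = 0")
  case False
  define z where "z = x epowr (1 - 1 / p)"
  have z: "0 < z" "z < top" 
    using epowr_finite_pos[of x] False fin by (auto simp: z_def zero_less_iff_neq_zero)
  have "z * x epowr (1 / p) = x"
    using p by (simp add: z_def epowr_add[symmetric])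
  also have "x \<le> z * (c * a epowr (1 / p))"
    using le by (simp add: z_def mult_ac)
  finally have "x epowr (1 / p) \<le> c * a epowr (1 / p)"
    using z by (simp add: ennreal_mult_le_mult_iff)
  then have "(x epowr (1 / p)) epowr p \<le> (c * a epowr (1 / p)) epowr p"
    using p by (intro epowr_mono) auto
  then show ?thesis using p by (simp add: epowr_epowr epowr_mult)
qed auto

lemma epowr_young:
  assumes t: "0 < t" "t < 1"
  shows "x epowr t * y epowr (1 - t) \<le> ennreal t * x + ennreal (1 - t) * y"
proof (cases x rule: ennreal_cases_pos)
  case (pos a)
  show ?thesis
  proof (cases y rule: ennreal_cases_pos)
    case (pos b)
    with \<open>0 < a\<close> \<open>x = ennreal a\<close> t Youngs_inequality_0[of t "1 - t" a b] show ?thesis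
      by (simp add: epowr_ennreal ennreal_mult[symmetric] ennreal_plus[symmetric] del: ennreal_plus)
  qed (use t in \<open>auto simp: ennreal_mult_top\<close>)
next
  case top
  then show ?thesis using t by (auto simp: ennreal_mult_top)
qed (use t in auto)

lemma nn_integral_Markov:
  assumes u: "u \<in> borel_measurable M"
  shows "c * emeasure M {x \<in> space M. c \<le> u x} \<le> (\<integral>\<^sup>+x. u x \<partial>M)"
proof -
  note [measurable] = u
  have "c * emeasure M {x \<in> space M. c \<le> u x} = (\<integral>\<^sup>+x\<in>{x \<in> space M. c \<le> u x}. c \<partial>M)"
    by (subst nn_integral_cmult_indicator) auto
  also have "\<dots> \<le> (\<integral>\<^sup>+x. u x \<partial>M)"
    by (intro nn_integral_mono) (auto simp: indicator_def)
  finally show ?thesis .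
qed

text \<open>Hoelder's inequality for the exponents \<open>1/t\<close> and \<open>1/(1-t)\<close>, in the form in which both factors
  enter through their integrals. Young's inequality is integrated after normalising both integrals to \<open>1\<close>;
  if one integral vanishes, so does the product almost everywhere.\<close>

lemma nn_integral_Holder:
  assumes [measurable]: "F \<in> borel_measurable M" "G \<in> borel_measurable M" and t: "0 < t" "t < 1"
  shows "(\<integral>\<^sup>+x. F x epowr t * G x epowr (1 - t) \<partial>M)
    \<le> (\<integral>\<^sup>+x. F x \<partial>M) epowr t * (\<integral>\<^sup>+x. G x \<partial>M) epowr (1 - t)"
proof -
  define A where "A = (\<integral>\<^sup>+x. F x \<partial>M)"
  define B where "B = (\<integral>\<^sup>+x. G x \<partial>M)"
  consider "A = 0 \<or> B = 0" | "A \<noteq> 0" "B \<noteq> 0" "A = top \<or> B = top" | "0 < A" "A < top" "0 < B" "B < top"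
    by (auto simp: zero_less_iff_neq_zero less_top[symmetric])
  then show ?thesis
  proof cases
    case 1
    then have "AE x in M. F x epowr t * G x epowr (1 - t) = 0"
    proof
      assume "A = 0"
      then have "AE x in M. F x = 0" by (simp add: A_def nn_integral_0_iff_AE)
      then show ?thesis by eventually_elim (use t in simp)
    next
      assume "B = 0"
      then have "AE x in M. G x = 0" by (simp add: B_def nn_integral_0_iff_AE)
      then show ?thesis by eventually_elim (use t in simp)
    qed
    then have "(\<integral>\<^sup>+x. F x epowr t * G x epowr (1 - t) \<partial>M) = 0"
      by (simp add: nn_integral_0_iff_AE)
    then show ?thesis by simp
  next
    case 2
    then have "A epowr t * B epowr (1 - t) = top"
      using t by (auto simp: ennreal_top_mult ennreal_mult_top epowr_pos_iff)
    then show ?thesis by (simp add: A_def B_def)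
  next
    case 3
    define c where "c = A epowr t * B epowr (1 - t)"
    have A1: "A * (1 / A) = 1" "B * (1 / B) = 1"
      using 3 by (auto simp: ennreal_times_divide)
    have "(\<integral>\<^sup>+x. F x epowr t * G x epowr (1 - t) \<partial>M)
      = (\<integral>\<^sup>+x. c * ((F x * (1 / A)) epowr t * (G x * (1 / B)) epowr (1 - t)) \<partial>M)"
    proof (intro nn_integral_cong)
      fix x
      have "F x epowr t * G x epowr (1 - t)
        = (A * (1 / A) * F x) epowr t * (B * (1 / B) * G x) epowr (1 - t)"
        by (simp only: A1) simp
      then show "F x epowr t * G x epowr (1 - t)
        = c * ((F x * (1 / A)) epowr t * (G x * (1 / B)) epowr (1 - t))"
        using t by (simp add: c_def epowr_mult mult_ac)
    qed
    also have "\<dots> = c * (\<integral>\<^sup>+x. (F x * (1 / A)) epowr t * (G x * (1 / B)) epowr (1 - t) \<partial>M)"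
      by (simp add: nn_integral_cmult)
    also have "\<dots> \<le> c * (\<integral>\<^sup>+x. ennreal t * (F x * (1 / A)) + ennreal (1 - t) * (G x * (1 / B)) \<partial>M)"
      by (intro mult_left_mono nn_integral_mono epowr_young t) auto
    also have "(\<integral>\<^sup>+x. ennreal t * (F x * (1 / A)) + ennreal (1 - t) * (G x * (1 / B)) \<partial>M)
      = ennreal t * (A * (1 / A)) + ennreal (1 - t) * (B * (1 / B))"
      by (simp add: nn_integral_add nn_integral_cmult nn_integral_multc A_def B_def)
    also have "\<dots> = 1"
      using t by (simp only: A1) (simp add: ennreal_plus[symmetric] del: ennreal_plus)
    finally show ?thesis by (simp add: c_def A_def B_def)
  qed
qed

lemma sum_Holder:
  fixes F G :: "'i \<Rightarrow> ennreal"
  assumes "finite I" "0 < t" "t < 1"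
  shows "(\<Sum>i\<in>I. F i epowr t * G i epowr (1 - t)) \<le> (\<Sum>i\<in>I. F i) epowr t * (\<Sum>i\<in>I. G i) epowr (1 - t)"
  using nn_integral_Holder[of F "count_space I" G t] assms
  by (simp add: nn_integral_count_space_finite)

text \<open>A pathwise form of Doob's argument. When the running maximum increases from \<open>a\<close> to \<open>b\<close>, the increment of its
  \<open>p\<close>-th power is controlled by \<open>b\<close> times the increment of its \<open>(p-1)\<close>-st power; this is Young's
  inequality. The factor \<open>b\<close> is the new average, which can be traded for the function itself after integration.\<close>

lemma power_increment:
  fixes a b :: ennreal
  assumes p: "1 < p"
  shows "(max a b) epowr p \<le> a epowr p + ennreal (p / (p - 1)) * (b * (max a b epowr (p - 1) - a epowr (p - 1)))"
proof (cases "b \<le> a")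
  case False
  then have ab: "a < b" by simp
  then obtain r where r: "a = ennreal r" "0 \<le> r" by (cases a) auto
  show ?thesis
  proof (cases b)
    case (real s)
    with ab r have rs: "r < s" "0 < s" by (auto simp: ennreal_less_iff)
    have "p * (s * r powr (p - 1)) \<le> (p - 1) * r powr p + s powr p"
    proof (cases "r = 0")
      case False
      have "(s powr p) powr (1 / p) * (r powr p) powr (1 - 1 / p) \<le> 1 / p * s powr p + (1 - 1 / p) * r powr p"
        by (rule Youngs_inequality_0) (use p rs r False in auto)
      moreover have "(s powr p) powr (1 / p) = s" "(r powr p) powr (1 - 1 / p) = r powr (p - 1)"
        using p rs by (auto simp: powr_powr right_diff_distrib)
      ultimately have "p * (s * r powr (p - 1)) \<le> p * (1 / p * s powr p + (1 - 1 / p) * r powr p)"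
        using p by simp
      also have "\<dots> = (p - 1) * r powr p + s powr p" using p by (simp add: field_simps)
      finally show ?thesis .
    qed (use p in auto)
    moreover have "s * s powr (p - 1) = s powr p"
      using rs by (simp add: powr_mult_base)
    ultimately have "(p - 1) * s powr p \<le> (p - 1) * r powr p + p * (s * (s powr (p - 1) - r powr (p - 1)))"
      by (simp add: algebra_simps)
    then have main: "s powr p \<le> r powr p + p / (p - 1) * (s * (s powr (p - 1) - r powr (p - 1)))"
      using p by (simp add: field_simps)
    have mono: "r powr (p - 1) \<le> s powr (p - 1)"
      using rs r p by (intro powr_mono2) auto
    show ?thesis
      using main mono rs r p ab real
      by (simp add: max_def epowr_ennreal_pos ennreal_minus ennreal_mult[symmetric] ennreal_plus[symmetric]
          del: ennreal_plus)
  next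
    case top
    have "a epowr (p - 1) < top" using r p by (simp add: epowr_ennreal_pos)
    then have "top - a epowr (p - 1) = top" by (auto simp: ennreal_top_minus)
    then show ?thesis using top p by (simp add: max_def ennreal_mult_top top_unique)
  qed
qed (simp add: max_absorb1)

section \<open>Filtrations by nested partitions and maximal averages\<close>

text \<open>One generation of cells for every natural number, larger indices meaning finer cells. A function
  \<open>cell k\<close> of the point, rather than a set of cubes, lets sums over the cubes through a point
  be written as sums over \<open>k\<close>.\<close>

locale filtration =
  fixes cell :: "nat \<Rightarrow> 'a \<Rightarrow> 'a set"
  assumes cell_self [simp, intro]: "x \<in> cell k x"
    and cell_eq: "y \<in> cell k x \<Longrightarrow> cell k y = cell k x"
    and cell_Suc: "cell (Suc k) x \<subseteq> cell k x"
    and countable_cells: "countable (range (cell k))"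
begin

lemma cell_mono: "k \<le> l \<Longrightarrow> cell l x \<subseteq> cell k x"
  by (induction l rule: dec_induct) (use cell_Suc in auto)

lemma cell_sym: "y \<in> cell k x \<Longrightarrow> x \<in> cell k y"
  using cell_eq by blast

text \<open>Measurability with respect to the \<open>k\<close>-th partition.\<close>

definition adapted :: "nat \<Rightarrow> ('a \<Rightarrow> 'b) \<Rightarrow> bool" where
  "adapted k a \<longleftrightarrow> (\<forall>x. \<forall>y\<in>cell k x. a y = a x)"

lemma adaptedI: "(\<And>x y. y \<in> cell k x \<Longrightarrow> a y = a x) \<Longrightarrow> adapted k a"
  by (simp add: adapted_def)

lemma adaptedD: "adapted k a \<Longrightarrow> y \<in> cell k x \<Longrightarrow> a y = a x"
  by (simp add: adapted_def)

lemma adapted_mono: "adapted k a \<Longrightarrow> k \<le> l \<Longrightarrow> adapted l a"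
  using cell_mono[of k l] by (meson adapted_def subsetD)

lemma adapted_cell: "adapted k (\<lambda>x. c (cell k x))"
  by (auto simp: adapted_def dest: cell_eq)

lemma adapted_indicator_cell: "l \<le> k \<Longrightarrow> adapted k (indicator (cell l x) :: 'a \<Rightarrow> 'b :: zero_neq_one)"
proof (rule adapted_mono, rule adaptedI)
  fix y z assume "z \<in> cell l y"
  then have "z \<in> cell l x \<longleftrightarrow> y \<in> cell l x"
    using cell_eq cell_self by blast
  then show "indicator (cell l x) z = (indicator (cell l x) y :: 'b)"
    by (simp add: indicator_def)
qed

end

locale measured_filtration = filtration cell for cell :: "nat \<Rightarrow> 'a \<Rightarrow> 'a set" +
  fixes M :: "'a measure"
  assumes space_M [simp]: "space M = UNIV"
    and cell_sets [measurable, simp]: "cell k x \<in> sets M"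
    and cell_pos: "0 < emeasure M (cell k x)"
    and cell_finite: "emeasure M (cell k x) < top"
begin

text \<open>The average over the cell of generation \<open>k\<close> through the point, that is, the conditional expectation.\<close>

definition E :: "nat \<Rightarrow> ('a \<Rightarrow> ennreal) \<Rightarrow> 'a \<Rightarrow> ennreal" where
  "E k h x = (\<integral>\<^sup>+y\<in>cell k x. h y \<partial>M) / emeasure M (cell k x)"

lemma adapted_E: "adapted k (E k h)"
  unfolding E_def by (rule adapted_cell)

lemma E_cong_cell: "y \<in> cell k x \<Longrightarrow> E k h y = E k h x"
  using adapted_E by (rule adaptedD)

lemma E_cell: "E k h x * emeasure M (cell k x) = (\<integral>\<^sup>+y\<in>cell k x. h y \<partial>M)"
  unfolding E_def using cell_pos[of k x] cell_finite[of k x]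
  by (simp add: ennreal_divide_times ennreal_times_divide[symmetric])

lemma adapted_sets: 
  assumes "adapted k P" shows "{x. P x} \<in> sets M"
proof -
  have "{x. P x} = \<Union> {C \<in> range (cell k). C \<subseteq> {x. P x}}"
    using assms by (auto simp: adapted_def)
  also have "\<dots> \<in> sets M"
    by (rule sets.countable_Union) (use countable_cells[of k] in \<open>auto intro: countable_subset[rotated]\<close>)
  finally show ?thesis .
qed

lemma adapted_measurable: 
  assumes "adapted k (a :: 'a \<Rightarrow> ennreal)" shows "a \<in> borel_measurable M"
proof (rule measurableI)
  fix S :: "ennreal set"
  have "adapted k (\<lambda>x. a x \<in> S)" using assms by (simp add: adapted_def)
  then show "a -` S \<inter> space M \<in> sets M" using adapted_sets by (simp add: vimage_def)
qed auto

lemma measurable_E [measurable]: "E k h \<in> borel_measurable M"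
  using adapted_E by (rule adapted_measurable)

text \<open>The partition is countable, so the integral is a sum over cells, written as an integral
  over the counting measure to have Fubini at hand.\<close>

lemma nn_integral_cells:
  assumes [measurable]: "F \<in> borel_measurable M"
  shows "(\<integral>\<^sup>+x. F x \<partial>M) = (\<integral>\<^sup>+C. (\<integral>\<^sup>+x\<in>C. F x \<partial>M) \<partial>count_space (range (cell k)))"
proof -
  let ?R = "range (cell k)"
  have "(\<integral>\<^sup>+C. (\<integral>\<^sup>+x\<in>C. F x \<partial>M) \<partial>count_space ?R)
    = (\<integral>\<^sup>+x. (\<integral>\<^sup>+C. F x * indicator C x \<partial>count_space ?R) \<partial>M)"
    by (rule nn_integral_count_space_nn_integral[symmetric]) (auto intro: countable_cells)
  also have "\<dots> = (\<integral>\<^sup>+x. F x \<partial>M)"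
  proof (rule nn_integral_cong)
    fix x
    have "(\<integral>\<^sup>+C. F x * indicator C x \<partial>count_space ?R) = F x * (\<integral>\<^sup>+C. indicator {cell k x} C \<partial>count_space ?R)"
      by (subst nn_integral_cmult[symmetric], simp, intro nn_integral_cong)
        (auto simp: indicator_def dest: cell_eq)
    also have "\<dots> = F x" by simp
    finally show "(\<integral>\<^sup>+C. F x * indicator C x \<partial>count_space ?R) = F x" .
  qed
  finally show ?thesis by simp
qed

lemma cell_integral_E:
  assumes a: "adapted k a" and [measurable]: "h \<in> borel_measurable M"
  shows "(\<integral>\<^sup>+y\<in>cell k x. a y * E k h y \<partial>M) = (\<integral>\<^sup>+y\<in>cell k x. a y * h y \<partial>M)"
proof -
  have "(\<integral>\<^sup>+y\<in>cell k x. a y * E k h y \<partial>M) = (\<integral>\<^sup>+y. a x * E k h x * indicator (cell k x) y \<partial>M)"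
    by (intro nn_integral_cong) (auto simp: indicator_def adaptedD[OF a] E_cong_cell)
  also have "\<dots> = a x * (E k h x * emeasure M (cell k x))"
    by (subst nn_integral_cmult_indicator) (auto simp: mult_ac)
  also have "\<dots> = (\<integral>\<^sup>+y. a x * (h y * indicator (cell k x) y) \<partial>M)"
    by (simp add: E_cell nn_integral_cmult)
  also have "\<dots> = (\<integral>\<^sup>+y\<in>cell k x. a y * h y \<partial>M)"
    by (intro nn_integral_cong) (auto simp: indicator_def adaptedD[OF a])
  finally show ?thesis .
qed

text \<open>The defining property of a conditional expectation: factors that are constant on the cells can be pulled out.\<close>

lemma integral_E:
  assumes a: "adapted k a" and [measurable]: "h \<in> borel_measurable M"
  shows "(\<integral>\<^sup>+y. a y * E k h y \<partial>M) = (\<integral>\<^sup>+y. a y * h y \<partial>M)"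
proof -
  have [measurable]: "a \<in> borel_measurable M" using a by (rule adapted_measurable)
  have "(\<integral>\<^sup>+y\<in>C. a y * E k h y \<partial>M) = (\<integral>\<^sup>+y\<in>C. a y * h y \<partial>M)" if "C \<in> range (cell k)" for C
    using that cell_integral_E[OF a, of h] by auto
  then have "(\<integral>\<^sup>+C. (\<integral>\<^sup>+y\<in>C. a y * E k h y \<partial>M) \<partial>count_space (range (cell k)))
    = (\<integral>\<^sup>+C. (\<integral>\<^sup>+y\<in>C. a y * h y \<partial>M) \<partial>count_space (range (cell k)))"
    by (rule nn_integral_cong) simp
  then show ?thesis
    by (subst (1 2) nn_integral_cells[where k = k]) simp_all
qed

lemma E_mono: "(\<And>y. y \<in> cell k x \<Longrightarrow> h y \<le> g y) \<Longrightarrow> E k h x \<le> E k g x"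
  unfolding E_def by (intro divide_right_mono_ennreal nn_integral_mono) (auto simp: indicator_def)

lemma E_le_iff: "E k h x \<le> c \<longleftrightarrow> (\<integral>\<^sup>+y\<in>cell k x. h y \<partial>M) \<le> c * emeasure M (cell k x)"
proof -
  have "E k h x \<le> c \<longleftrightarrow> emeasure M (cell k x) * E k h x \<le> emeasure M (cell k x) * c"
    using cell_pos[of k x] cell_finite[of k x] by (simp add: ennreal_mult_le_mult_iff)
  then show ?thesis by (metis E_cell mult.commute)
qed

lemma E_cmult:
  "h \<in> borel_measurable M \<Longrightarrow> E k (\<lambda>y. c * h y) x = c * E k h x"
  unfolding E_def by (simp add: nn_integral_cmult mult.assoc ennreal_times_divide)

lemma E_sum:
  assumes [measurable]: "\<And>i. i \<in> I \<Longrightarrow> h i \<in> borel_measurable M"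
  shows "E k (\<lambda>y. \<Sum>i\<in>I. h i y) x = (\<Sum>i\<in>I. E k (h i) x)"
  unfolding E_def 
  by (simp add: sum_distrib_right nn_integral_sum divide_ennreal_def)

lemma E_jensen:
  assumes p: "1 < p" and [measurable]: "h \<in> borel_measurable M"
  shows "E k h x epowr p \<le> E k (\<lambda>y. h y epowr p) x"
proof -
  let ?Q = "cell k x" and ?m = "emeasure M (cell k x)"
  let ?F = "\<lambda>y. h y epowr p * indicator ?Q y"
  have "E k h x * ?m = (\<integral>\<^sup>+y. ?F y epowr (1 / p) * indicator ?Q y epowr (1 - 1 / p) \<partial>M)"
    unfolding E_cell using p
    by (intro nn_integral_cong) (auto simp: indicator_def epowr_epowr)
  also have "\<dots> \<le> (\<integral>\<^sup>+y. ?F y \<partial>M) epowr (1 / p) * (\<integral>\<^sup>+y. indicator ?Q y \<partial>M) epowr (1 - 1 / p)"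
    by (rule nn_integral_Holder) (use p in auto)
  also have "\<dots> = (E k (\<lambda>y. h y epowr p) x * ?m) epowr (1 / p) * ?m epowr (1 - 1 / p)"
    by (simp add: E_cell)
  also have "\<dots> = E k (\<lambda>y. h y epowr p) x epowr (1 / p) * ?m"
    using p by (simp add: epowr_mult epowr_add[symmetric] mult.assoc)
  finally have "E k h x \<le> E k (\<lambda>y. h y epowr p) x epowr (1 / p)"
    using cell_pos[of k x] cell_finite[of k x] by (simp add: ennreal_mult_le_mult_iff mult.commute)
  then show ?thesis using p by (simp add: epowr_le_iff)
qed

text \<open>Minkowski's inequality by duality: the sequence of averages is paired with its own power \<open>q - 1\<close>.
  Partial sums are finite unless some average is infinite, so the power can be absorbed.\<close>

lemma E_Minkowski:
  assumes q: "1 < q" and [measurable]: "\<And>i. f i \<in> borel_measurable M"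
  shows "(\<Sum>i. E k (f i) x epowr q) \<le> E k (\<lambda>y. (\<Sum>i. f i y epowr q) epowr (1 / q)) x epowr q"
proof -
  define g where "g y = (\<Sum>i. f i y epowr q) epowr (1 / q)" for y
  have [measurable]: "g \<in> borel_measurable M" unfolding g_def by measurable
  have fg: "f i y \<le> g y" for i y
    unfolding g_def epowr_le_iff[symmetric, of q, OF less_trans[OF zero_less_one q]]
    by (rule order_trans[OF _ sum_le_suminf[of _ "{i}"]]) auto
  have "(\<Sum>i<n. E k (f i) x epowr q) \<le> E k g x epowr q" for n
  proof (cases "(\<Sum>i<n. E k (f i) x epowr q) < top")
    case False
    then obtain i where "E k (f i) x epowr q = top"
      by (auto simp: less_top[symmetric])
    with q have "E k (f i) x = top" by (simp add: epowr_top_iff)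
    then have "E k g x = top" using E_mono[of k x "f i" g] fg by (simp add: top_unique)
    then show ?thesis using q by simp
  next
    case True
    define X where "X = (\<Sum>i<n. E k (f i) x epowr q)"
    have "X = (\<Sum>i<n. E k (f i) x epowr (q - 1) * E k (f i) x)"
      unfolding X_def using q
      by (intro sum.cong refl) (metis add_diff_cancel_left' diff_add_cancel diff_ge_0_iff_ge epowr_add epowr_one less_eq_real_def zero_le_one)
    also have "\<dots> = E k (\<lambda>y. \<Sum>i<n. E k (f i) x epowr (q - 1) * f i y) x"
      by (simp add: E_sum E_cmult)
    also have "\<dots> \<le> E k (\<lambda>y. X epowr (1 - 1 / q) * g y) x"
    proof (rule E_mono)
      fix y
      have "(\<Sum>i<n. E k (f i) x epowr (q - 1) * f i y)
        = (\<Sum>i<n. (f i y epowr q) epowr (1 / q) * (E k (f i) x epowr q) epowr (1 - 1 / q))"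
        using q by (simp add: epowr_epowr right_diff_distrib mult.commute)
      also have "\<dots> \<le> (\<Sum>i<n. f i y epowr q) epowr (1 / q) * (\<Sum>i<n. E k (f i) x epowr q) epowr (1 - 1 / q)"
        by (rule sum_Holder) (use q in auto)
      also have "\<dots> \<le> g y * X epowr (1 - 1 / q)"
        unfolding g_def X_def using q
        by (intro mult_right_mono epowr_mono sum_le_suminf) auto
      finally show "(\<Sum>i<n. E k (f i) x epowr (q - 1) * f i y) \<le> X epowr (1 - 1 / q) * g y"
        by (simp add: mult.commute)
    qed
    also have "\<dots> = 1 * (E k g x epowr q) epowr (1 / q) * X epowr (1 - 1 / q)"
      using q by (simp add: E_cmult epowr_epowr) (simp add: mult.commute)
    finally have "X \<le> 1 epowr q * (E k g x epowr q)"
      by (rule absorb_power[OF q]) (use True in \<open>simp add: X_def\<close>)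
    then show ?thesis by (simp add: X_def)
  qed
  then show ?thesis unfolding g_def[symmetric] by (intro suminf_le_const) auto
qed

definition mx :: "nat \<Rightarrow> ('a \<Rightarrow> ennreal) \<Rightarrow> 'a \<Rightarrow> ennreal" where
  "mx n h x = (SUP l\<in>{..n}. E l h x)"

lemma mx_Suc: "mx (Suc n) h x = max (mx n h x) (E (Suc n) h x)"
  by (simp add: mx_def atMost_Suc sup_max max.commute)

lemma adapted_mx: "adapted n (mx n h)"
  unfolding mx_def using adaptedD[OF adapted_mono[OF adapted_E]]
  by (intro adaptedI SUP_cong) auto

lemma measurable_mx [measurable]: "mx n h \<in> borel_measurable M"
  using adapted_mx by (rule adapted_measurable)

lemma E_le_mx: "l \<le> n \<Longrightarrow> E l h x \<le> mx n h x"
  unfolding mx_def by (auto intro: SUP_upper)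

text \<open>Telescoping \<open>power_increment\<close> over the generations. The increments of the \<open>(p-1)\<close>-st power are adapted,
  so each average in front of them may be replaced by \<open>h\<close>.\<close>

lemma Doob_pre:
  assumes p: "1 < p" and [measurable]: "h \<in> borel_measurable M"
  shows "(\<integral>\<^sup>+x. mx n h x epowr p \<partial>M) \<le> ennreal (p / (p - 1)) * (\<integral>\<^sup>+x. h x * mx n h x epowr (p - 1) \<partial>M)"
proof (induction n)
  case 0
  have eq: "E 0 h x epowr p = E 0 h x epowr (p - 1) * E 0 h x" for x
    using epowr_add[of "p - 1" 1 "E 0 h x"] p by simp
  have a: "adapted 0 (\<lambda>x. E 0 h x epowr (p - 1))"
    using adapted_E[of 0 h] by (auto simp: adapted_def)
  have "1 \<le> p / (p - 1)" using p by simp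
  then have "1 \<le> ennreal (p / (p - 1))" by simp
  moreover have "(\<integral>\<^sup>+x. mx 0 h x epowr p \<partial>M) = (\<integral>\<^sup>+x. h x * mx 0 h x epowr (p - 1) \<partial>M)"
    using integral_E[OF a, of h] by (simp add: mx_def eq mult.commute)
  ultimately show ?case
    by (metis mult_right_mono mult_1 zero_le)
next
  case (Suc n)
  let ?c = "ennreal (p / (p - 1))"
  define D where "D x = mx (Suc n) h x epowr (p - 1) - mx n h x epowr (p - 1)" for x
  have D: "mx n h x epowr (p - 1) + D x = mx (Suc n) h x epowr (p - 1)" for x
    unfolding D_def using p by (intro add_diff_inverse_ennreal epowr_mono) (auto simp: mx_Suc)
  have aD: "adapted (Suc n) D"
    using adapted_mx[of "Suc n" h] adapted_mono[OF adapted_mx[of n h], of "Suc n"]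
    by (auto simp: D_def adapted_def)
  have [measurable]: "D \<in> borel_measurable M" using aD by (rule adapted_measurable)
  have "(\<integral>\<^sup>+x. mx (Suc n) h x epowr p \<partial>M) \<le> (\<integral>\<^sup>+x. mx n h x epowr p + ?c * (D x * E (Suc n) h x) \<partial>M)"
    using power_increment[OF p] by (intro nn_integral_mono) (simp add: mx_Suc D_def mult.commute)
  also have "\<dots> = (\<integral>\<^sup>+x. mx n h x epowr p \<partial>M) + ?c * (\<integral>\<^sup>+x. D x * E (Suc n) h x \<partial>M)"
    by (simp add: nn_integral_add nn_integral_cmult)
  also have "\<dots> \<le> ?c * (\<integral>\<^sup>+x. h x * mx n h x epowr (p - 1) \<partial>M) + ?c * (\<integral>\<^sup>+x. D x * h x \<partial>M)"
    using Suc integral_E[OF aD, of h] by (auto intro: add_mono)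
  also have "\<dots> = ?c * (\<integral>\<^sup>+x. h x * (mx n h x epowr (p - 1) + D x) \<partial>M)"
    by (simp add: nn_integral_add[symmetric] distrib_left[symmetric])
      (simp add: distrib_left mult.commute)
  finally show ?case by (simp add: D)
qed

text \<open>Hoelder's inequality in \<open>Doob_pre\<close> gives the bound once the left-hand side is known to be finite,
  which follows from \<open>mx n h epowr p \<le> (\<Sum>l\<le>n. E l (h epowr p))\<close>.\<close>

theorem Doob:
  assumes p: "1 < p" and [measurable]: "h \<in> borel_measurable M"
  shows "(\<integral>\<^sup>+x. mx n h x epowr p \<partial>M) \<le> ennreal (p / (p - 1)) epowr p * (\<integral>\<^sup>+x. h x epowr p \<partial>M)"
proof (cases "(\<integral>\<^sup>+x. h x epowr p \<partial>M) < top")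
  case True
  let ?c = "ennreal (p / (p - 1))"
  have "(\<integral>\<^sup>+x. mx n h x epowr p \<partial>M) \<le> (\<integral>\<^sup>+x. (\<Sum>l\<le>n. E l (\<lambda>y. h y epowr p) x) \<partial>M)"
  proof (rule nn_integral_mono)
    fix x
    have "mx n h x epowr p = (SUP l\<in>{..n}. E l h x epowr p)"
      using p by (simp add: mx_def SUP_epowr)
    also have "\<dots> \<le> (\<Sum>l\<le>n. E l (\<lambda>y. h y epowr p) x)"
    proof (rule SUP_least)
      fix l assume l: "l \<in> {..n}"
      have "E l h x epowr p \<le> E l (\<lambda>y. h y epowr p) x" using p by (rule E_jensen) simp
      also have "\<dots> \<le> (\<Sum>l\<le>n. E l (\<lambda>y. h y epowr p) x)" using l by (intro member_le_sum) auto
      finally show "E l h x epowr p \<le> (\<Sum>l\<le>n. E l (\<lambda>y. h y epowr p) x)" .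
    qed
    finally show "mx n h x epowr p \<le> (\<Sum>l\<le>n. E l (\<lambda>y. h y epowr p) x)" .
  qed
  also have "\<dots> = (\<Sum>l\<le>n. \<integral>\<^sup>+x. h x epowr p \<partial>M)"
  proof -
    have "(\<integral>\<^sup>+x. E l (\<lambda>y. h y epowr p) x \<partial>M) = (\<integral>\<^sup>+x. h x epowr p \<partial>M)" for l
      using integral_E[of l "\<lambda>_. 1" "\<lambda>y. h y epowr p"] by (simp add: adapted_def)
    then show ?thesis by (simp add: nn_integral_sum)
  qed
  also have "\<dots> < top" using True by (simp add: ennreal_mult_less_top of_nat_less_top)
  finally have fin: "(\<integral>\<^sup>+x. mx n h x epowr p \<partial>M) < top" .
  have "(\<integral>\<^sup>+x. h x * mx n h x epowr (p - 1) \<partial>M)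
      = (\<integral>\<^sup>+x. (h x epowr p) epowr (1 / p) * (mx n h x epowr p) epowr (1 - 1 / p) \<partial>M)"
    using p by (simp add: epowr_epowr right_diff_distrib)
  also have "\<dots> \<le> (\<integral>\<^sup>+x. h x epowr p \<partial>M) epowr (1 / p) * (\<integral>\<^sup>+x. mx n h x epowr p \<partial>M) epowr (1 - 1 / p)"
    by (rule nn_integral_Holder) (use p in auto)
  finally have "(\<integral>\<^sup>+x. mx n h x epowr p \<partial>M) \<le>
      ?c * ((\<integral>\<^sup>+x. h x epowr p \<partial>M) epowr (1 / p) * (\<integral>\<^sup>+x. mx n h x epowr p \<partial>M) epowr (1 - 1 / p))"
    using Doob_pre[OF p, of h n] by (meson assms(2) mult_left_mono order_trans zero_le)
  then show ?thesis
    using absorb_power[OF p _ fin, of ?c] by (simp add: mult.assoc)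
next
  case False
  have "0 < ennreal (p / (p - 1)) epowr p" using p by (simp add: epowr_ennreal)
  then show ?thesis using False by (simp add: less_top[symmetric] ennreal_mult_top)
qed

end

section \<open>Sparse domination of the vector-valued maximal function\<close>

locale vector_filtration = measured_filtration cell M for cell :: "nat \<Rightarrow> 'a \<Rightarrow> 'a set" and M +
  fixes D :: real and q :: real and f :: "nat \<Rightarrow> 'a \<Rightarrow> ennreal"
  assumes D: "1 \<le> D" and doubling: "emeasure M (cell k x) \<le> ennreal D * emeasure M (cell (Suc k) x)"
    and q: "1 < q" and measurable_f [measurable]: "\<And>i. f i \<in> borel_measurable M"
begin

lemma E_Suc_le: "E (Suc k) h x \<le> ennreal D * E k h x"
proof -
  have "(\<integral>\<^sup>+y\<in>cell (Suc k) x. h y \<partial>M) \<le> (\<integral>\<^sup>+y\<in>cell k x. h y \<partial>M)"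
    using cell_Suc[of k x] by (intro nn_integral_mono) (auto simp: indicator_def)
  also have "\<dots> \<le> E k h x * (ennreal D * emeasure M (cell (Suc k) x))"
    unfolding E_cell[symmetric] by (intro mult_left_mono doubling) auto
  finally show ?thesis by (simp add: E_le_iff mult_ac)
qed

text \<open>The pointwise \<open>\<ell>\<^sup>q\<close> norm of the sequence.\<close>

definition g :: "'a \<Rightarrow> ennreal" where
  "g y = (\<Sum>i. f i y epowr q) epowr (1 / q)"

lemma measurable_g [measurable]: "g \<in> borel_measurable M"
  unfolding g_def by measurable

lemma f_le_g: "f i y \<le> g y"
  unfolding g_def epowr_le_iff[symmetric, of q, OF less_trans[OF zero_less_one q]]
  by (rule order_trans[OF _ sum_le_suminf[of _ "{i}"]]) auto

lemma E_f_le_g: "(\<Sum>i. E k (f i) x epowr q) \<le> E k g x epowr q"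
  using E_Minkowski[OF q measurable_f] by (simp add: g_def[abs_def])

text \<open>The \<open>q\<close>-th power of the \<open>\<ell>\<^sup>q\<close> norm of the maximal functions over the generations \<open>t, \<dots>, k\<close>.\<close>

definition seg :: "nat \<Rightarrow> nat \<Rightarrow> 'a \<Rightarrow> ennreal" where
  "seg t k x = (\<Sum>i. (SUP l\<in>{t..k}. E l (f i) x) epowr q)"

text \<open>The stopping threshold: \<open>q/(q-1)\<close> is the constant in Doob's inequality, \<open>4 D\<close> bounds the stopped averages of \<open>g\<close>
  relative to the initial one, and the last factor \<open>4\<close> makes the exceptional set small.\<close>

definition A :: ennreal where "A = 4 * (ennreal (q / (q - 1)) * (ennreal D * 4))"

text \<open>The generation of the smallest principal cell among those of generation at most \<open>k\<close> through \<open>x\<close>: a new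
  principal cell is chosen as soon as the maximal functions restarted at the current one become large.
  Thus the cell of generation \<open>k\<close> is principal iff \<open>principal x k = k\<close>.\<close>

primrec principal :: "'a \<Rightarrow> nat \<Rightarrow> nat" where
  "principal x 0 = 0"
| "principal x (Suc k) = (if (A * E (principal x k) g x) epowr q < seg (principal x k) (Suc k) x then Suc k else principal x k)"

lemma A_ge_1: "1 \<le> A"
proof -
  have "1 \<le> q / (q - 1)" using q by simp
  then have "1 * (1 * (1 * 1)) \<le> A"
    unfolding A_def using D by (intro mult_mono) auto
  then show ?thesis by simp
qed

lemma seg_mono: "k \<le> l \<Longrightarrow> seg t k x \<le> seg t l x"
  unfolding seg_def using q
  by (intro suminf_le epowr_mono SUP_subset_mono) auto

lemma seg_cell: "l \<le> k \<Longrightarrow> y \<in> cell k x \<Longrightarrow> seg t l y = seg t l x"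
  unfolding seg_def
  by (intro suminf_cong arg_cong2[of _ _ _ _ "(epowr)"] SUP_cong refl
      adaptedD[OF adapted_mono[OF adapted_E]]) auto

lemma principal_le: "principal x k \<le> k"
  by (induction k) (auto intro: le_SucI)

lemma principal_idem: "principal x (principal x k) = principal x k"
  by (induction k) auto

lemma principal_cell: "l \<le> k \<Longrightarrow> y \<in> cell k x \<Longrightarrow> principal y l = principal x l"
proof (induction l)
  case (Suc l)
  then have "principal y l = principal x l" by simp
  moreover have "E (principal x l) g y = E (principal x l) g x"
    using Suc principal_le[of x l] adaptedD[OF adapted_mono[OF adapted_E, of "principal x l" k]] by simp
  ultimately show ?case using Suc.prems by (simp add: seg_cell)
qed simp

text \<open>Between two restarts the threshold has not been exceeded; at a restart only one generation is involved and
  Minkowski's inequality applies.\<close>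

lemma seg_principal: "seg (principal x k) k x \<le> (A * E (principal x k) g x) epowr q"
proof (induction k)
  case 0
  have "seg 0 0 x \<le> E 0 g x epowr q" using E_f_le_g by (simp add: seg_def)
  also have "\<dots> \<le> (A * E 0 g x) epowr q"
    using q mult_right_mono[OF A_ge_1, of "E 0 g x"] by (intro epowr_mono) auto
  finally show ?case by simp
next
  case (Suc k)
  have "seg (Suc k) (Suc k) x \<le> E (Suc k) g x epowr q" using E_f_le_g by (simp add: seg_def)
  also have "\<dots> \<le> (A * E (Suc k) g x) epowr q"
    using q mult_right_mono[OF A_ge_1, of "E (Suc k) g x"] by (intro epowr_mono) auto
  finally show ?case using Suc by (simp add: not_less)
qed

text \<open>Splitting the range of generations costs no constant, because the larger of two \<open>q\<close>-th powers is at most their sum.\<close>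

lemma split_SUP: "(\<Sum>i. (SUP l\<in>{..k}. E l (f i) x) epowr q)
    \<le> (\<Sum>i. (SUP l\<in>{..<t}. E l (f i) x) epowr q) + seg t k x"
proof -
  have "(SUP l\<in>{..k}. E l (f i) x) epowr q
    \<le> (SUP l\<in>{..<t}. E l (f i) x) epowr q + (SUP l\<in>{t..k}. E l (f i) x) epowr q" for i
  proof -
    have "(SUP l\<in>{..k}. E l (f i) x) \<le> (SUP l\<in>{..<t} \<union> {t..k}. E l (f i) x)"
      by (intro SUP_subset_mono) auto
    also have "\<dots> = max (SUP l\<in>{..<t}. E l (f i) x) (SUP l\<in>{t..k}. E l (f i) x)"
      by (simp add: SUP_union sup_max)
    finally show ?thesis
      using epowr_mono[of q] max_epowr_le[of q] q by (meson less_eq_real_def order_trans zero_less_one less_trans)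
  qed
  then have "(\<Sum>i. (SUP l\<in>{..k}. E l (f i) x) epowr q)
      \<le> (\<Sum>i. (SUP l\<in>{..<t}. E l (f i) x) epowr q + (SUP l\<in>{t..k}. E l (f i) x) epowr q)"
    by (intro suminf_le) auto
  then show ?thesis by (simp add: seg_def suminf_add[symmetric])
qed

text \<open>The completed blocks of generations, one for each principal cell except the current one, are
  summed up by induction.\<close>

lemma sparse_domination_aux:
  "(\<Sum>i. (SUP l\<in>{..<principal x n}. E l (f i) x) epowr q)
    \<le> (\<Sum>k<principal x n. if principal x k = k then (A * E k g x) epowr q else 0)"
proof (induction n)
  case 0
  then show ?case using q by (simp add: bot_ennreal)
next
  case (Suc n)
  let ?c = "\<lambda>k. if principal x k = k then (A * E k g x) epowr q else 0"
  show ?case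
  proof (cases "principal x (Suc n) = Suc n")
    case True
    have "(\<Sum>i. (SUP l\<in>{..n}. E l (f i) x) epowr q)
      \<le> (\<Sum>k<principal x n. ?c k) + (A * E (principal x n) g x) epowr q"
      using split_SUP[where k = n and x = x and t = "principal x n"] Suc seg_principal[of x n] by (meson add_mono order_trans)
    also have "\<dots> = (\<Sum>k<Suc (principal x n). ?c k)" by (simp add: principal_idem)
    also have "\<dots> \<le> (\<Sum>k<Suc n. ?c k)"
      using principal_le[of x n] by (intro sum_mono2) auto
    finally show ?thesis unfolding True by (simp add: lessThan_Suc_atMost)
  next
    case False
    then have "principal x (Suc n) = principal x n" by (auto split: if_splits)
    with Suc show ?thesis by simp
  qed
qed

text \<open>The \<open>q\<close>-th power of the vector maximal function is at most the sum over the blocks between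
  consecutive restarts, each of which obeys \<open>seg_principal\<close>.\<close>

lemma sparse_domination:
  "(\<Sum>i. mx n (f i) x epowr q) \<le> (\<Sum>k\<le>n. if principal x k = k then (A * E k g x) epowr q else 0)"
proof -
  let ?c = "\<lambda>k. if principal x k = k then (A * E k g x) epowr q else 0"
  have "(\<Sum>i. mx n (f i) x epowr q) \<le> (\<Sum>k<principal x n. ?c k) + (A * E (principal x n) g x) epowr q"
    unfolding mx_def
    using split_SUP[where k = n and x = x and t = "principal x n"] sparse_domination_aux[of x n] seg_principal[of x n] by (meson add_mono order_trans)
  also have "\<dots> = (\<Sum>k<Suc (principal x n). ?c k)" by (simp add: principal_idem)
  also have "\<dots> \<le> (\<Sum>k\<le>n. ?c k)"
    using principal_le[of x n] by (intro sum_mono2) auto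
  finally show ?thesis .
qed

lemma principal_change:
  assumes "principal y t = t" "t \<le> n" "principal y n \<noteq> t"
  shows "(A * E t g y) epowr q < seg t n y"
  using assms(2,3)
proof (induction n rule: dec_induct)
  case (step n)
  show ?case
  proof (cases "principal y n = t")
    case True
    then show ?thesis using step by (auto split: if_splits)
  next
    case False
    with step have "(A * E t g y) epowr q < seg t n y" by simp
    also have "\<dots> \<le> seg t (Suc n) y" by (rule seg_mono) simp
    finally show ?thesis .
  qed
qed (use assms in simp)

text \<open>A stopping time for the averages of \<open>g\<close>; the default value \<open>n\<close> lets the stopped function agree with the
  average of generation \<open>n\<close> wherever the averages stay small.\<close>

definition stop :: "nat \<Rightarrow> nat \<Rightarrow> ennreal \<Rightarrow> 'a \<Rightarrow> nat" where
  "stop t n c y = (LEAST j. t \<le> j \<and> (j = n \<or> c < E j g y))"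

context
  fixes t n :: nat and c :: ennreal
  assumes tn: "t \<le> n"
begin

lemma stop_prop: "t \<le> stop t n c y \<and> (stop t n c y = n \<or> c < E (stop t n c y) g y)"
  unfolding stop_def by (rule LeastI[of _ n]) (use tn in auto)

lemma stop_le: "stop t n c y \<le> n"
  unfolding stop_def by (rule Least_le) (use tn in auto)

lemma before_stop: "t \<le> i \<Longrightarrow> i < stop t n c y \<Longrightarrow> E i g y \<le> c"
  using not_less_Least[of i "\<lambda>j. t \<le> j \<and> (j = n \<or> c < E j g y)"] by (auto simp: stop_def)

lemma stop_geI: "l \<le> n \<Longrightarrow> (\<And>j. t \<le> j \<Longrightarrow> j < l \<Longrightarrow> E j g y \<le> c) \<Longrightarrow> l \<le> stop t n c y"
  using stop_prop[of y] by (metis leD leI)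

lemma adapted_stop: "adapted j (\<lambda>y. stop t n c y = j)"
proof -
  have "stop t n c y = j" if y: "y \<in> cell j x" and j: "stop t n c x = j" for x y
  proof -
    have eq: "E i g y = E i g x" if "i \<le> j" for i
      using adaptedD[OF adapted_mono[OF adapted_E that] y] .
    show ?thesis
    proof (rule order_antisym)
      show "stop t n c y \<le> j"
        unfolding stop_def
        by (rule Least_le) (use stop_prop[of x] j eq in auto)
      show "j \<le> stop t n c y"
        using before_stop[of _ x] j eq stop_le[of x] by (intro stop_geI) auto
    qed
  qed
  then show ?thesis by (intro adaptedI) (metis cell_sym)
qed

lemma measurable_stop [measurable]: "stop t n c \<in> measurable M (count_space UNIV)"
  using adapted_sets[OF adapted_stop] by (simp add: measurable_count_space_eq2_countable vimage_def)

lemma measurable_stopped [measurable]: "(\<lambda>z. E (stop t n c z) h z) \<in> borel_measurable M"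
  by (rule measurable_compose_countable[where f = "\<lambda>j z. E j h z" and g = "stop t n c"]) measurable

text \<open>Optional stopping. On the cell in question the stopping generation takes finitely many values \<open>j \<ge> l\<close>, and the
  set where it equals \<open>j\<close> is a union of cells of generation \<open>j\<close>.\<close>

lemma cell_integral_stopped:
  assumes [measurable]: "h \<in> borel_measurable M" and l: "\<And>z. z \<in> cell l y \<Longrightarrow> l \<le> stop t n c z"
  shows "(\<integral>\<^sup>+z\<in>cell l y. E (stop t n c z) h z \<partial>M) = (\<integral>\<^sup>+z\<in>cell l y. h z \<partial>M)"
proof -
  define a :: "nat \<Rightarrow> 'a \<Rightarrow> ennreal" where
    "a j z = indicator (cell l y) z * (if stop t n c z = j then 1 else 0)" for j z
  have aj: "adapted j (a j)" if "l \<le> j" for j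
  proof (rule adaptedI)
    have ind: "adapted j (indicator (cell l y) :: 'a \<Rightarrow> ennreal)"
      using that by (rule adapted_indicator_cell)
    fix x z assume z: "z \<in> cell j x"
    show "a j z = a j x"
      using adaptedD[OF adapted_stop z] adaptedD[OF ind z]
      by (simp add: a_def)
  qed
  have [measurable]: "a j \<in> borel_measurable M" for j
    unfolding a_def by measurable
  have one: "(\<Sum>j\<in>{l..n}. a j z * b j) = b (stop t n c z) * indicator (cell l y) z" for b :: "nat \<Rightarrow> ennreal" and z
  proof (cases "z \<in> cell l y")
    case True
    then have "(\<Sum>j\<in>{l..n}. a j z * b j) = (\<Sum>j\<in>{l..n}. if stop t n c z = j then b j else 0)"
      by (intro sum.cong) (auto simp: a_def)
    also have "\<dots> = b (stop t n c z)"
      using l[OF True] stop_le[of z] by (subst sum.delta') auto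
    finally show ?thesis using True by simp
  qed (simp add: a_def)
  have "(\<integral>\<^sup>+z\<in>cell l y. E (stop t n c z) h z \<partial>M) = (\<integral>\<^sup>+z. (\<Sum>j\<in>{l..n}. a j z * E j h z) \<partial>M)"
    by (rule nn_integral_cong) (simp only: one)
  also have "\<dots> = (\<Sum>j\<in>{l..n}. \<integral>\<^sup>+z. a j z * E j h z \<partial>M)"
    by (rule nn_integral_sum) simp
  also have "\<dots> = (\<Sum>j\<in>{l..n}. \<integral>\<^sup>+z. a j z * h z \<partial>M)"
    using integral_E[OF aj, of _ h] by (intro sum.cong) auto
  also have "\<dots> = (\<integral>\<^sup>+z. (\<Sum>j\<in>{l..n}. a j z * h z) \<partial>M)"
    by (rule nn_integral_sum[symmetric]) simp
  also have "\<dots> = (\<integral>\<^sup>+z\<in>cell l y. h z \<partial>M)"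
    by (rule nn_integral_cong) (simp only: one)
  finally show ?thesis .
qed

text \<open>At the generation before stopping the average was at most \<open>c\<close>, and one step multiplies it by at most \<open>D\<close>.
  This replaces the bound for the good part in a Calderon-Zygmund decomposition.\<close>

lemma stopped_g_le: 
  assumes "E t g y \<le> c" shows "E (stop t n c y) g y \<le> ennreal D * c"
proof (cases "stop t n c y = t")
  case True
  have "1 * c \<le> ennreal D * c" using D by (intro mult_right_mono) auto
  then show ?thesis unfolding True using assms by simp
next
  case False
  then obtain i where i: "stop t n c y = Suc i" "t \<le> i"
    using stop_prop[of y] by (metis Suc_le_D le_antisym not_less_eq_eq)
  have "E (Suc i) g y \<le> ennreal D * E i g y" by (rule E_Suc_le)
  also have "\<dots> \<le> ennreal D * c"
    using before_stop[of i y] i by (intro mult_left_mono) auto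
  finally show ?thesis using i by simp
qed

end

end

context vector_filtration begin

text \<open>The stopped sequence is bounded in \<open>\<ell>\<^sup>q\<close> by \<open>D c\<close>, pointwise, so the strong type estimate for each component
  gives a bound proportional to the measure of the cell.\<close>

lemma stopped_l2:
  assumes tn: "t \<le> n" and gx: "E t g x \<le> c"
  defines "F \<equiv> \<lambda>i y. indicator (cell t x) y * E (stop t n c y) (f i) y"
  shows "(\<integral>\<^sup>+y. (\<Sum>i. mx n (F i) y epowr q) \<partial>M)
    \<le> (ennreal (q / (q - 1)) * (ennreal D * c)) epowr q * emeasure M (cell t x)"
proof -
  have [measurable]: "F i \<in> borel_measurable M" for i
    unfolding F_def using measurable_stopped[OF tn] by measurable
  have "(\<integral>\<^sup>+y. (\<Sum>i. mx n (F i) y epowr q) \<partial>M) = (\<Sum>i. \<integral>\<^sup>+y. mx n (F i) y epowr q \<partial>M)"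
    by (rule nn_integral_suminf) simp
  also have "\<dots> \<le> (\<Sum>i. ennreal (q / (q - 1)) epowr q * (\<integral>\<^sup>+y. F i y epowr q \<partial>M))"
    by (intro suminf_le Doob q) auto
  also have "\<dots> = ennreal (q / (q - 1)) epowr q * (\<integral>\<^sup>+y. (\<Sum>i. F i y epowr q) \<partial>M)"
    by (simp add: nn_integral_suminf)
  also have "(\<integral>\<^sup>+y. (\<Sum>i. F i y epowr q) \<partial>M) \<le> (\<integral>\<^sup>+y. (ennreal D * c) epowr q * indicator (cell t x) y \<partial>M)"
  proof (rule nn_integral_mono)
    fix y
    show "(\<Sum>i. F i y epowr q) \<le> (ennreal D * c) epowr q * indicator (cell t x) y"
    proof (cases "y \<in> cell t x")
      case True
      then have gy: "E t g y \<le> c" using gx by (simp add: E_cong_cell)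
      have "(\<Sum>i. F i y epowr q) = (\<Sum>i. E (stop t n c y) (f i) y epowr q)"
        using True by (simp add: F_def)
      also have "\<dots> \<le> E (stop t n c y) g y epowr q" by (rule E_f_le_g)
      also have "\<dots> \<le> (ennreal D * c) epowr q"
        using q by (intro epowr_mono stopped_g_le[OF tn gy]) auto
      finally show ?thesis using True by simp
    qed (use q in \<open>simp add: F_def\<close>)
  qed
  also have "\<dots> = (ennreal D * c) epowr q * emeasure M (cell t x)"
    by (simp add: nn_integral_cmult_indicator)
  finally show ?thesis
    using q by (simp add: epowr_mult[of q "ennreal (q / (q - 1))"] mult_left_mono mult.assoc)
qed

text \<open>Where the averages of \<open>g\<close> never become large, stopping does not change the averages of the components.\<close>

lemma E_stopped:
  assumes tn: "t \<le> n" and l: "t \<le> l" "l \<le> n" and y: "y \<in> cell t x"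
    and small: "\<And>j. t \<le> j \<Longrightarrow> j \<le> n \<Longrightarrow> E j g y \<le> c" and [measurable]: "h \<in> borel_measurable M"
  shows "E l (\<lambda>y. indicator (cell t x) y * E (stop t n c y) h y) y = E l h y"
proof -
  have sub: "cell l y \<subseteq> cell t x" using cell_mono[OF l(1), of y] cell_eq[OF y] by simp
  have "l \<le> stop t n c z" if z: "z \<in> cell l y" for z
  proof (rule stop_geI[OF tn l(2)])
    fix j assume j: "t \<le> j" "j < l"
    then have "E j g z = E j g y" using z by (intro adaptedD[OF adapted_mono[OF adapted_E, of j l]]) auto
    then show "E j g z \<le> c" using small[of j] j l by simp
  qed
  then have "(\<integral>\<^sup>+z\<in>cell l y. E (stop t n c z) h z \<partial>M) = (\<integral>\<^sup>+z\<in>cell l y. h z \<partial>M)"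
    by (intro cell_integral_stopped tn) auto
  moreover have "(\<integral>\<^sup>+z\<in>cell l y. (indicator (cell t x) z * E (stop t n c z) h z) \<partial>M)
      = (\<integral>\<^sup>+z\<in>cell l y. E (stop t n c z) h z \<partial>M)"
    using sub by (intro nn_integral_cong) (auto simp: indicator_def)
  ultimately show ?thesis by (simp add: E_def)
qed

text \<open>The weak type \<open>(1,1)\<close> estimate for the vector maximal function. Either the averages of \<open>g\<close>
  exceed four times the initial one, which by Chebyshev's inequality happens on at most a quarter of the
  cell (the set \<open>U\<close>), or the maximal functions are those of the stopped sequence and the \<open>L\<^sup>q\<close> bound applies (the set \<open>B\<close>).\<close>

lemma seg_large_measure:
  assumes tn: "t \<le> n" and G: "0 < E t g x" "E t g x < top"
  shows "2 * emeasure M {y \<in> cell t x. (A * E t g x) epowr q < seg t n y} \<le> emeasure M (cell t x)"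
proof -
  define G where "G = E t g x"
  have G: "0 < G" "G < top" using G by (auto simp: G_def)
  define c where "c = 4 * G"
  define m where "m = emeasure M (cell t x)"
  have m: "0 < m" "m < top" using cell_pos cell_finite by (auto simp: m_def)
  have Gc: "E t g x \<le> c" 
    using mult_right_mono[of 1 4 G] by (simp add: c_def G_def)
  define F where "F = (\<lambda>i y. indicator (cell t x) y * E (stop t n c y) (f i) y)"
  have [measurable]: "F i \<in> borel_measurable M" for i
    unfolding F_def using measurable_stopped[OF tn] by measurable
  define Z where "Z y = (\<Sum>i. mx n (F i) y epowr q)" for y
  have [measurable]: "Z \<in> borel_measurable M" unfolding Z_def by measurable
  define U where "U = {y \<in> space M. c \<le> E (stop t n c y) g y * indicator (cell t x) y}"
  define B where "B = {y \<in> space M. (A * G) epowr q \<le> Z y}"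
  define X where "X = (ennreal (q / (q - 1)) * (ennreal D * c)) epowr q"
  have [measurable]: "(\<lambda>y. E (stop t n c y) g y) \<in> borel_measurable M" by (rule measurable_stopped[OF tn])
  have UB: "U \<in> sets M" "B \<in> sets M" unfolding U_def B_def by measurable
  have c: "0 < c" "c < top" using G by (auto simp: c_def ennreal_mult_less_top ennreal_zero_less_mult_iff)
  have X: "0 < X" "X < top"
  proof -
    have "0 < ennreal (q / (q - 1)) * (ennreal D * c)" "ennreal (q / (q - 1)) * (ennreal D * c) < top"
      using c q D by (auto simp: ennreal_mult_less_top ennreal_zero_less_mult_iff)
    then show "0 < X" "X < top" unfolding X_def using epowr_finite_pos by auto
  qed
  have "(A * G) epowr q = (4 * (ennreal (q / (q - 1)) * (ennreal D * c))) epowr q"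
    by (simp add: A_def c_def mult_ac)
  also have "\<dots> = 4 epowr q * X"
    using q by (simp add: X_def epowr_mult)
  finally have AG: "(A * G) epowr q = 4 epowr q * X" .
  have four: "4 \<le> 4 epowr q"
  proof -
    have "4 epowr 1 \<le> ennreal (4 powr q)"
      unfolding epowr_one using q powr_mono[of 1 q 4] by (simp add: ennreal_leI flip: ennreal_numeral)
    then show ?thesis using epowr_ennreal[of 4 q] by simp
  qed
  have "4 * emeasure M U \<le> m"
  proof -
    have "c * emeasure M U \<le> (\<integral>\<^sup>+y\<in>cell t x. E (stop t n c y) g y \<partial>M)"
      unfolding U_def by (rule nn_integral_Markov) measurable
    also have "\<dots> = (\<integral>\<^sup>+y\<in>cell t x. g y \<partial>M)"
      using stop_prop[OF tn] by (subst cell_integral_stopped[OF tn]) auto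
    also have "\<dots> = G * m" by (simp add: E_cell[symmetric] G_def m_def)
    finally have "G * (4 * emeasure M U) \<le> G * m" by (simp add: c_def mult_ac)
    then show ?thesis using G by (simp add: ennreal_mult_le_mult_iff)
  qed
  have "4 * emeasure M B \<le> m"
  proof -
    have "(A * G) epowr q * emeasure M B \<le> (\<integral>\<^sup>+y. Z y \<partial>M)"
      unfolding B_def by (rule nn_integral_Markov) measurable
    also have "\<dots> \<le> X * m"
      using stopped_l2[OF tn Gc] by (simp add: Z_def F_def X_def m_def)
    finally have "X * (4 epowr q * emeasure M B) \<le> X * m" unfolding AG by (simp add: mult_ac)
    then have "4 epowr q * emeasure M B \<le> m" using X by (simp add: ennreal_mult_le_mult_iff)
    then show ?thesis using mult_right_mono[OF four, of "emeasure M B"] by simp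
  qed
  have "{y \<in> cell t x. (A * E t g x) epowr q < seg t n y} \<subseteq> U \<union> B"
  proof clarify
    fix y assume y: "y \<in> cell t x" and big: "(A * E t g x) epowr q < seg t n y" and "y \<notin> B"
    have "\<not> (\<forall>j. t \<le> j \<longrightarrow> j \<le> n \<longrightarrow> E j g y \<le> c)"
    proof
      assume small: "\<forall>j. t \<le> j \<longrightarrow> j \<le> n \<longrightarrow> E j g y \<le> c"
      have "seg t n y \<le> Z y"
        unfolding seg_def Z_def
      proof (intro suminf_le epowr_mono SUP_least)
        fix i l assume l: "l \<in> {t..n}"
        have "E l (F i) y = E l (f i) y"
          unfolding F_def by (rule E_stopped[OF tn]) (use l y small in auto)
        then show "E l (f i) y \<le> mx n (F i) y"
          using E_le_mx[of l n "F i" y] l by simp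
      qed (use q in auto)
      with big \<open>y \<notin> B\<close> show False by (simp add: G_def B_def)
    qed
    then obtain j where j: "t \<le> j" "j \<le> n" "c < E j g y" by (auto simp: not_le)
    then have "stop t n c y \<le> j" unfolding stop_def by (intro Least_le) auto
    moreover have "stop t n c y = n \<or> c < E (stop t n c y) g y" using stop_prop[OF tn] by auto
    ultimately have "c \<le> E (stop t n c y) g y" using j by auto
    then show "y \<in> U" using y by (simp add: U_def)
  qed
  then have "emeasure M {y \<in> cell t x. (A * E t g x) epowr q < seg t n y} \<le> emeasure M (U \<union> B)"
    using UB by (intro emeasure_mono) auto
  also have "\<dots> \<le> emeasure M U + emeasure M B"
    using UB by (rule emeasure_subadditive)
  finally have "4 * emeasure M {y \<in> cell t x. (A * E t g x) epowr q < seg t n y} \<le> 4 * emeasure M U + 4 * emeasure M B"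
    by (metis distrib_left mult_left_mono zero_le)
  also have "\<dots> \<le> m + m" using \<open>4 * emeasure M U \<le> m\<close> \<open>4 * emeasure M B \<le> m\<close> by (rule add_mono)
  finally have "2 * (2 * emeasure M {y \<in> cell t x. (A * E t g x) epowr q < seg t n y}) \<le> 2 * m"
    unfolding mult_2[of m] by (simp add: mult.assoc[symmetric])
  then show ?thesis unfolding m_def by (subst (asm) ennreal_mult_le_mult_iff) auto
qed

text \<open>A point of the cell belongs to a later principal cell only if the threshold was exceeded there, so the weak
  type estimate applies. If the average of \<open>g\<close> is \<open>0\<close> or infinite the threshold is never exceeded.\<close>

lemma principal_half:
  assumes t: "principal x t = t" and tn: "t \<le> n"
  shows "emeasure M (cell t x) \<le> 2 * emeasure M {y \<in> cell t x. principal y n = t}"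
proof -
  let ?G = "{y \<in> cell t x. principal y n = t}" and ?B = "{y \<in> cell t x. principal y n \<noteq> t}"
  define m where "m = emeasure M (cell t x)"
  have "adapted n (\<lambda>y. principal y n = t)"
    by (intro adaptedI) (simp add: principal_cell[of n n])
  then have [measurable]: "Measurable.pred M (\<lambda>y. principal y n = t)"
    using adapted_sets by (simp add: pred_def)
  have [measurable]: "Measurable.pred M (\<lambda>y. y \<in> cell t x)" by (simp add: pred_def)
  have "?G = {y \<in> space M. y \<in> cell t x \<and> principal y n = t}" "?B = {y \<in> space M. y \<in> cell t x \<and> principal y n \<noteq> t}"
    by auto
  then have sets: "?G \<in> sets M" "?B \<in> sets M" by auto
  have sub: "(A * E t g x) epowr q < seg t n y" if "y \<in> ?B" for y
  proof -
    have "principal y t = t" using principal_cell[of t t y x] that t by simp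
    then show ?thesis using principal_change[of y t n] tn that E_cong_cell[of y t x g] by simp
  qed
  have "2 * emeasure M ?B \<le> m"
  proof -
    consider "E t g x = 0" | "E t g x = top" | "0 < E t g x" "E t g x < top"
      by (auto simp: zero_less_iff_neq_zero less_top[symmetric])
    then show ?thesis
    proof cases
      case 1
      have "seg t n y = 0" if y: "y \<in> cell t x" for y
      proof -
        have "E l (f i) y = 0" if l: "t \<le> l" for l i
        proof -
          have "(\<integral>\<^sup>+z\<in>cell l y. f i z \<partial>M) \<le> (\<integral>\<^sup>+z\<in>cell t x. g z \<partial>M)"
            using cell_mono[OF l, of y] cell_eq[OF y] f_le_g
            by (intro nn_integral_mono) (auto simp: indicator_def)
          also have "\<dots> = 0" using 1 by (simp add: E_cell[symmetric])
          finally show ?thesis by (simp add: E_def)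
        qed
        then have "(SUP l\<in>{t..n}. E l (f i) y) = 0" for i
          by (intro antisym SUP_least) auto
        then show ?thesis using q by (simp add: seg_def)
      qed
      then have "?B = {}" using sub by fastforce
      then have "emeasure M ?B = 0" by (simp only: emeasure_empty)
      then show ?thesis by simp
    next
      case 2
      have "A \<noteq> 0" using A_ge_1 by auto
      then have "(A * E t g x) epowr q = top" using 2 q by (simp add: ennreal_mult_top)
      then have "?B = {}" using sub by fastforce
      then have "emeasure M ?B = 0" by (simp only: emeasure_empty)
      then show ?thesis by simp
    next
      case 3
      have "adapted n (seg t n)" by (intro adaptedI seg_cell) auto
      then have [measurable]: "seg t n \<in> borel_measurable M" by (rule adapted_measurable)
      have "{y \<in> cell t x. (A * E t g x) epowr q < seg t n y}
        = {y \<in> space M. y \<in> cell t x \<and> (A * E t g x) epowr q < seg t n y}" by auto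
      also have "\<dots> \<in> sets M" by measurable
      finally have "emeasure M ?B \<le> emeasure M {y \<in> cell t x. (A * E t g x) epowr q < seg t n y}"
        using sub by (intro emeasure_mono) auto
      then have "2 * emeasure M ?B \<le> 2 * emeasure M {y \<in> cell t x. (A * E t g x) epowr q < seg t n y}"
        by (rule mult_left_mono) simp
      also have "\<dots> \<le> m" unfolding m_def by (rule seg_large_measure[OF tn 3])
      finally show ?thesis .
    qed
  qed
  moreover have "m = emeasure M ?G + emeasure M ?B"
    unfolding m_def using sets by (subst plus_emeasure) (auto intro!: arg_cong[where f = "emeasure M"])
  moreover have "m + m = 2 * m" by (simp add: mult_2)
  ultimately have "m + m \<le> 2 * emeasure M ?G + m"
    by (simp add: distrib_left add_left_mono)
  then have "m + m \<le> m + 2 * emeasure M ?G" by (simp only: add.commute)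
  then have "m = top \<or> m \<le> 2 * emeasure M ?G" by (simp only: ennreal_add_left_cancel_le infinity_ennreal_def)
  then show ?thesis using cell_finite[of t x] by (auto simp: m_def)
qed

end

section \<open>The weighted estimate in one filtration\<close>

text \<open>The average of \<open>\<phi> v\<close> is the average of \<open>v\<close> times the average of \<open>\<phi>\<close> with respect to the measure \<open>v dM\<close>; in this
  way weighted averages, and Doob's inequality for them, enter.\<close>

lemma (in measured_filtration) E_density:
  assumes v: "measured_filtration cell (density M v)" 
    and [measurable]: "v \<in> borel_measurable M" "\<phi> \<in> borel_measurable M"
  shows "E k (\<lambda>y. \<phi> y * v y) x = E k v x * measured_filtration.E cell (density M v) k \<phi> x"
proof -
  interpret V: measured_filtration cell "density M v" by (rule v)
  have "(\<integral>\<^sup>+y\<in>cell k x. (\<phi> y * v y) \<partial>M) = (\<integral>\<^sup>+y\<in>cell k x. \<phi> y \<partial>density M v)"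
    by (subst nn_integral_density) (auto simp: mult_ac)
  also have "\<dots> = V.E k \<phi> x * emeasure (density M v) (cell k x)" by (simp add: V.E_cell)
  also have "emeasure (density M v) (cell k x) = E k v x * emeasure M (cell k x)"
    by (simp add: emeasure_density E_cell)
  finally have "E k (\<lambda>y. \<phi> y * v y) x = (V.E k \<phi> x * E k v x * emeasure M (cell k x)) / emeasure M (cell k x)"
    by (simp add: E_def[of k "\<lambda>y. \<phi> y * v y"] mult.assoc)
  then show ?thesis
    using cell_pos[of k x] cell_finite[of k x] by (simp add: mult_divide_eq_ennreal mult.commute[of "E k v x"])
qed

lemma (in measured_filtration) density_filtration:
  assumes [measurable]: "v \<in> borel_measurable M" and pos: "\<And>x. 0 < v x" and fin: "\<And>k x. E k v x < top"
  shows "measured_filtration cell (density M v)"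
proof unfold_locales
  fix k x
  have eq: "emeasure (density M v) (cell k x) = E k v x * emeasure M (cell k x)"
    by (simp add: emeasure_density E_cell)
  show "emeasure (density M v) (cell k x) < top"
    using fin cell_finite by (simp add: eq ennreal_mult_less_top)
  show "0 < emeasure (density M v) (cell k x)"
  proof (rule ccontr)
    assume "\<not> ?thesis"
    then have "AE y in M. v y * indicator (cell k x) y = 0"
      by (simp add: emeasure_density nn_integral_0_iff_AE)
    then have "AE y in M. y \<notin> cell k x"
      by eventually_elim (use pos in \<open>auto simp: indicator_def zero_less_iff_neq_zero\<close>)
    then have "emeasure M (cell k x) = 0"
      using AE_iff_null[of M "\<lambda>y. y \<notin> cell k x"] by (auto simp: null_sets_def)
    then show False using cell_pos[of k x] by simp
  qed
qed auto

text \<open>The assumption named \<open>K\<close> bounds the mixed quantity on all cells, with one constant for the product of both characteristics.\<close>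

locale weighted_filtration = vector_filtration cell M D q f
  for cell :: "nat \<Rightarrow> 'a \<Rightarrow> 'a set" and M D q f +
  fixes w :: "'a \<Rightarrow> ennreal" and p r :: real and K :: ennreal
  assumes w [measurable]: "w \<in> borel_measurable M" and w_pos: "\<And>x. 0 < w x" and w_fin: "\<And>x. w x < top"
    and p: "q + 1 < p" and r: "1 < r"
    and E_w: "E k w x < top" and E_dual: "E k (\<lambda>y. w y epowr (- 1 / (p - 1))) x < top"
    and K: "(E k w x * E k (\<lambda>y. w y epowr (- 1 / (p - 1))) x epowr (p - 1)) epowr (1 / (p - 1)) *
      (E k w x * E k (\<lambda>y. w y epowr (- 1 / (r - 1))) x epowr (r - 1)) epowr (1 / q - 1 / (p - 1)) \<le> K"
begin

definition \<sigma> :: "'a \<Rightarrow> ennreal" where "\<sigma> y = w y epowr (- 1 / (p - 1))"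
definition \<nu> :: "'a \<Rightarrow> ennreal" where "\<nu> y = w y epowr (- 1 / (r - 1))"
definition \<gamma> :: real where "\<gamma> = 1 - q / (p - 1)"
text \<open>The exponent \<open>(r-1)\<gamma>\<close> with which the average of \<open>\<nu>\<close> occurs in \<open>A\<^sub>r\<close> to the power \<open>\<gamma>\<close>.\<close>

definition s :: real where "s = (r - 1) * \<gamma>"
text \<open>The function with \<open>g = h \<sigma>\<close>.\<close>

definition h :: "'a \<Rightarrow> ennreal" where "h y = g y * w y epowr (1 / (p - 1))"

lemma measurable_weights [measurable]:
  "\<sigma> \<in> borel_measurable M" "\<nu> \<in> borel_measurable M" "h \<in> borel_measurable M"
  unfolding \<sigma>_def \<nu>_def h_def by measurable

lemma \<gamma>_pos: "0 < \<gamma>" using p q by (simp add: \<gamma>_def)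
lemma s_pos: "0 < s" using r \<gamma>_pos by (simp add: s_def)

sublocale W: measured_filtration cell "density M w"
  using w_pos E_w by (intro density_filtration) auto

sublocale S: measured_filtration cell "density M \<sigma>"
  using E_dual epowr_finite_pos[OF w_pos w_fin]
  by (intro density_filtration) (auto simp: \<sigma>_def[abs_def])

lemma w_epowr_add: "w x epowr a * w x epowr b = w x epowr (a + b)"
  by (rule epowr_add_finite[OF w_pos w_fin, symmetric])

text \<open>Jensen's inequality for the negative power \<open>-s\<close> on the part of the cell outside later principal
  cells, multiplied out: since \<open>\<nu>\<^sup>-\<^sup>s = w\<^sup>\<gamma>\<close>, Hoelder's inequality with exponents \<open>(1+s)/s\<close> and \<open>1+s\<close> applied to
  the constant function \<open>1\<close> bounds the measure of that part, which is at least half of the cell.\<close>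

lemma jensen_good_part:
  assumes k: "principal x k = k" "k \<le> n"
  shows "1 \<le> 2 epowr (1 + s) * (E k \<nu> x epowr s * E k (\<lambda>y. (if principal y n = k then 1 else 0) * w y epowr \<gamma>) x)"
proof -
  let ?Q = "cell k x" and ?I = "\<lambda>y. (if principal y n = k then 1 else 0) :: ennreal"
  let ?F = "{y \<in> ?Q. principal y n = k}"
  define m where "m = emeasure M ?Q"
  have m: "0 < m" "m < top" using cell_pos cell_finite by (auto simp: m_def)
  define t where "t = s / (1 + s)"
  have t: "0 < t" "t < 1" "1 - t = 1 / (1 + s)" using s_pos by (auto simp: t_def field_simps)
  have "adapted n (\<lambda>y. principal y n = k)" by (intro adaptedI) (simp add: principal_cell[of n n])
  then have [measurable]: "Measurable.pred M (\<lambda>y. principal y n = k)" using adapted_sets by (simp add: pred_def)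
  have [measurable]: "?F \<in> sets M"
  proof -
    have "?F = {y \<in> space M. principal y n = k} \<inter> ?Q" by auto
    also have "\<dots> \<in> sets M" by measurable
    finally show ?thesis .
  qed
  \<comment> \<open>\<open>t = s/(1+s)\<close> is the exponent for which the powers of \<open>w\<close> in \<open>\<nu>\<^sup>t (w\<^sup>\<gamma>)\<^sup>1\<^sup>-\<^sup>t\<close> cancel.\<close>
  have half: "m \<le> 2 * emeasure M ?F" unfolding m_def by (rule principal_half[OF k])
  have "emeasure M ?F = (\<integral>\<^sup>+y. indicator ?F y \<partial>M)" by simp
  also have "\<dots> = (\<integral>\<^sup>+y. (\<nu> y * indicator ?Q y) epowr t * (?I y * w y epowr \<gamma> * indicator ?Q y) epowr (1 - t) \<partial>M)"
  proof (rule nn_integral_cong)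
    fix y
    have "- 1 / (r - 1) * t + \<gamma> * (1 - t) = 0"
      unfolding t(3) using r s_pos by (simp add: t_def s_def divide_simps)
    then have one: "(w y epowr (- 1 / (r - 1))) epowr t * (w y epowr \<gamma>) epowr (1 - t) = 1"
      by (simp add: epowr_epowr w_epowr_add)
    show "indicator ?F y = (\<nu> y * indicator ?Q y) epowr t * (?I y * w y epowr \<gamma> * indicator ?Q y) epowr (1 - t)"
      using t(1,2) one zero_epowr[of "1 - t"] by (simp add: indicator_def \<nu>_def)
  qed
  also have "\<dots> \<le> (\<integral>\<^sup>+y\<in>?Q. \<nu> y \<partial>M) epowr t * (\<integral>\<^sup>+y\<in>?Q. (?I y * w y epowr \<gamma>) \<partial>M) epowr (1 - t)"
    by (rule nn_integral_Holder) (use t in auto)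
  also have "\<dots> = E k \<nu> x epowr t * E k (\<lambda>y. ?I y * w y epowr \<gamma>) x epowr (1 - t) * m"
  proof -
    have "m epowr t * m epowr (1 - t) = m" using t(1,2) by (simp add: epowr_add[symmetric])
    moreover have "(a * m) epowr t * (b * m) epowr (1 - t)
        = a epowr t * b epowr (1 - t) * (m epowr t * m epowr (1 - t))" for a b
      using t(1,2) by (simp add: epowr_mult mult_ac)
    ultimately show ?thesis unfolding E_cell[symmetric] m_def[symmetric] by simp
  qed
  finally have le: "emeasure M ?F \<le> \<dots>" .
  have "m * 1 \<le> m * (2 * (E k \<nu> x epowr t * E k (\<lambda>y. ?I y * w y epowr \<gamma>) x epowr (1 - t)))"
    using order_trans[OF half mult_left_mono[OF le, of 2]] by (simp add: mult_ac)
  then have "1 \<le> 2 * (E k \<nu> x epowr t * E k (\<lambda>y. ?I y * w y epowr \<gamma>) x epowr (1 - t))"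
    using m by (simp only: ennreal_mult_le_mult_iff)
  then have "1 epowr (1 + s) \<le> (2 * (E k \<nu> x epowr t * E k (\<lambda>y. ?I y * w y epowr \<gamma>) x epowr (1 - t))) epowr (1 + s)"
    using s_pos by (intro epowr_mono) auto
  also have "\<dots> = 2 epowr (1 + s) * (E k \<nu> x epowr s * E k (\<lambda>y. ?I y * w y epowr \<gamma>) x)"
    using s_pos by (simp add: epowr_mult epowr_epowr t(3)) (simp add: t_def)
  finally show ?thesis by simp
qed

text \<open>The step that uses the mixed constant. The average of \<open>g\<close> produces \<open>(E k \<sigma>)\<^sup>q\<close>, that of \<open>\<phi> w\<close> produces \<open>E k w\<close>,
  and the exponents of the two characteristics are exactly those for which their product is
  \<open>(E k \<sigma>)\<^sup>q (E k w) (E k \<nu>)\<^sup>s\<close>; the factor \<open>(E k \<nu>)\<^sup>s\<close> is supplied by \<open>jensen_good_part\<close>.\<close>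

lemma principal_term_le:
  assumes k: "principal x k = k" "k \<le> n" and [measurable]: "\<phi> \<in> borel_measurable M"
  shows "E k g x epowr q * E k (\<lambda>y. \<phi> y * w y) x
    \<le> K epowr q * 2 epowr (1 + s) * ((S.E k h x epowr q * W.E k \<phi> x) *
        E k (\<lambda>y. (if principal y n = k then 1 else 0) * w y epowr \<gamma>) x)"
proof -
  let ?J = "E k (\<lambda>y. (if principal y n = k then 1 else 0) * w y epowr \<gamma>) x"
  have "h y * \<sigma> y = g y" for y
    by (simp add: h_def \<sigma>_def mult.assoc w_epowr_add)
  then have Eg: "E k g x = E k \<sigma> x * S.E k h x"
    using E_density[OF S.measured_filtration_axioms, of h k x] by simp
  have E\<phi>: "E k (\<lambda>y. \<phi> y * w y) x = E k w x * W.E k \<phi> x"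
    by (rule E_density[OF W.measured_filtration_axioms]) auto
  have "E k \<sigma> x epowr q * E k w x * E k \<nu> x epowr s
    = ((E k w x * E k \<sigma> x epowr (p - 1)) epowr (1 / (p - 1)) *
      (E k w x * E k \<nu> x epowr (r - 1)) epowr (1 / q - 1 / (p - 1))) epowr q"
  proof -
    have e: "(1 / q - 1 / (p - 1)) * q = \<gamma>" "0 < 1 / q - 1 / (p - 1)" using p q by (auto simp: \<gamma>_def field_simps)
    have "E k w x epowr (q / (p - 1)) * E k w x epowr \<gamma> = E k w x"
      using p q \<gamma>_pos by (simp add: epowr_add[symmetric]) (simp add: \<gamma>_def)
    moreover have "((E k w x * E k \<sigma> x epowr (p - 1)) epowr (1 / (p - 1)) *
      (E k w x * E k \<nu> x epowr (r - 1)) epowr (1 / q - 1 / (p - 1))) epowr q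
      = E k w x epowr (q / (p - 1)) * E k \<sigma> x epowr q * (E k w x epowr \<gamma> * E k \<nu> x epowr s)"
      using p q e \<gamma>_pos s_pos by (simp add: epowr_mult epowr_epowr s_def mult.assoc)
    moreover have "a * b * (c * d) = b * (a * c) * d" for a b c d :: ennreal
      by (simp only: mult_ac)
    ultimately show ?thesis by simp
  qed
  also have "\<dots> \<le> K epowr q"
    using K[of k x] q unfolding \<sigma>_def[abs_def] \<nu>_def[abs_def] by (intro epowr_mono) auto
  finally have main: "E k \<sigma> x epowr q * E k w x * E k \<nu> x epowr s \<le> K epowr q" .
  have "E k g x epowr q * E k (\<lambda>y. \<phi> y * w y) x
      = (S.E k h x epowr q * W.E k \<phi> x) * (E k \<sigma> x epowr q * E k w x) * 1"
    using q by (simp add: Eg E\<phi> epowr_mult mult_ac)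
  also have "\<dots> \<le> (S.E k h x epowr q * W.E k \<phi> x) * (E k \<sigma> x epowr q * E k w x) *
      (2 epowr (1 + s) * (E k \<nu> x epowr s * ?J))"
    by (intro mult_left_mono jensen_good_part k) auto
  also have "\<dots> = (E k \<sigma> x epowr q * E k w x * E k \<nu> x epowr s) *
      (2 epowr (1 + s) * ((S.E k h x epowr q * W.E k \<phi> x) * ?J))"
    by (simp add: mult_ac)
  also have "\<dots> \<le> K epowr q * (2 epowr (1 + s) * ((S.E k h x epowr q * W.E k \<phi> x) * ?J))"
    by (intro mult_right_mono main) auto
  finally show ?thesis by (simp add: mult.assoc)
qed

text \<open>The \<open>q\<close>-th power of the vector maximal function over the generations up to \<open>n\<close>.\<close>

definition vmax_q :: "nat \<Rightarrow> 'a \<Rightarrow> ennreal" where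
  "vmax_q n x = (\<Sum>i. mx n (f i) x epowr q)"

lemma measurable_vmax_q [measurable]: "vmax_q n \<in> borel_measurable M"
  unfolding vmax_q_def by measurable

text \<open>For fixed \<open>x\<close> the indicators of \<open>principal x n = k\<close> vanish for all but one \<open>k\<close>. The sum
  over generations therefore collapses to one term, which the maximal functions dominate.\<close>

lemma dual_form_pre:
  assumes [measurable]: "\<phi> \<in> borel_measurable M"
  shows "(\<integral>\<^sup>+x. vmax_q n x * (\<phi> x * w x) \<partial>M)
    \<le> A epowr q * (K epowr q * 2 epowr (1 + s)) *
      (\<integral>\<^sup>+x. S.mx n h x epowr q * W.mx n \<phi> x * w x epowr \<gamma> \<partial>M)"
proof -
  define b where "b k x = (if principal x k = k then E k g x epowr q else 0)" for k x
  define d where "d k x = S.E k h x epowr q * W.E k \<phi> x" for k x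
  define I where "I k y = (if principal y n = k then 1 else 0 :: ennreal)" for k y
  define c where "c = K epowr q * 2 epowr (1 + s)"
  have b: "adapted k (b k)" for k
    using principal_cell[of k k] E_cong_cell by (intro adaptedI) (simp add: b_def)
  have d: "adapted k (d k)" for k
    using S.E_cong_cell W.E_cong_cell by (intro adaptedI) (simp add: d_def)
  have I: "adapted n (I k)" for k
    using principal_cell[of n n] by (intro adaptedI) (simp add: I_def)
  note [measurable] = b[THEN adapted_measurable] d[THEN adapted_measurable] I[THEN adapted_measurable]
  have "(\<integral>\<^sup>+x. vmax_q n x * (\<phi> x * w x) \<partial>M) \<le> (\<integral>\<^sup>+x. A epowr q * (\<Sum>k\<le>n. b k x * (\<phi> x * w x)) \<partial>M)"
  proof (rule nn_integral_mono)
    fix x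
    have "vmax_q n x \<le> (\<Sum>k\<le>n. if principal x k = k then (A * E k g x) epowr q else 0)"
      unfolding vmax_q_def by (rule sparse_domination)
    also have "\<dots> = A epowr q * (\<Sum>k\<le>n. b k x)"
      unfolding sum_distrib_left using q by (intro sum.cong) (auto simp: b_def epowr_mult)
    finally show "vmax_q n x * (\<phi> x * w x) \<le> A epowr q * (\<Sum>k\<le>n. b k x * (\<phi> x * w x))"
      by (simp add: sum_distrib_right[symmetric] mult.assoc[symmetric] mult_right_mono)
  qed
  also have "\<dots> = A epowr q * (\<Sum>k\<le>n. \<integral>\<^sup>+x. b k x * E k (\<lambda>y. \<phi> y * w y) x \<partial>M)"
    using integral_E[OF b, where h = "\<lambda>y. \<phi> y * w y"] by (simp add: nn_integral_cmult nn_integral_sum)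
  also have "\<dots> \<le> A epowr q * (\<Sum>k\<le>n. \<integral>\<^sup>+x. c * (d k x * E k (\<lambda>y. I k y * w y epowr \<gamma>) x) \<partial>M)"
  proof (intro mult_left_mono sum_mono nn_integral_mono)
    fix k x assume "k \<in> {..n}"
    then show "b k x * E k (\<lambda>y. \<phi> y * w y) x \<le> c * (d k x * E k (\<lambda>y. I k y * w y epowr \<gamma>) x)"
      using principal_term_le[of x k n \<phi>] by (auto simp: b_def c_def d_def I_def)
  qed simp
  also have "\<dots> = A epowr q * (\<Sum>k\<le>n. c * (\<integral>\<^sup>+x. d k x * (I k x * w x epowr \<gamma>) \<partial>M))"
    by (simp add: nn_integral_cmult integral_E[OF d])
  also have "\<dots> = A epowr q * c * (\<integral>\<^sup>+x. (\<Sum>k\<le>n. d k x * (I k x * w x epowr \<gamma>)) \<partial>M)"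
    by (simp add: nn_integral_sum sum_distrib_left[symmetric] mult.assoc)
  also have "\<dots> \<le> A epowr q * c * (\<integral>\<^sup>+x. S.mx n h x epowr q * W.mx n \<phi> x * w x epowr \<gamma> \<partial>M)"
  proof (intro mult_left_mono nn_integral_mono)
    fix x
    have "(\<Sum>k\<le>n. d k x * (I k x * w x epowr \<gamma>)) = (\<Sum>k\<le>n. if principal x n = k then d k x * w x epowr \<gamma> else 0)"
      by (intro sum.cong) (auto simp: I_def)
    also have "\<dots> = d (principal x n) x * w x epowr \<gamma>"
      using principal_le[of x n] by (subst sum.delta') auto
    also have "\<dots> \<le> S.mx n h x epowr q * W.mx n \<phi> x * w x epowr \<gamma>"
      unfolding d_def using principal_le[of x n] q
      by (intro mult_right_mono mult_mono epowr_mono S.E_le_mx W.E_le_mx) auto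
    finally show "(\<Sum>k\<le>n. d k x * (I k x * w x epowr \<gamma>)) \<le> S.mx n h x epowr q * W.mx n \<phi> x * w x epowr \<gamma>" .
  qed simp
  finally show ?thesis by (simp add: c_def)
qed

text \<open>The factors come from sparse domination, from \<open>jensen_good_part\<close>, and from Doob's inequality in \<open>L\<^sup>p\<close> of the
  measure \<open>\<sigma>\<close> and in \<open>L\<^sup>u\<close> of the measure \<open>w\<close>, where \<open>u = p/(p-q)\<close> is the exponent dual to \<open>p/q\<close>.\<close>

definition C :: ennreal where
  "C = A epowr q * 2 epowr (1 + s) * (ennreal (p / (p - 1)) epowr p) epowr (q / p) *
    (ennreal ((p / (p - q)) / (p / (p - q) - 1)) epowr (p / (p - q))) epowr (1 - q / p)"

text \<open>Hoelder's inequality with the exponents \<open>p/q\<close> and its dual splits \<open>w\<^sup>\<gamma>\<close> into the two densities for which the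
  maximal functions of \<open>h\<close> and \<open>\<phi>\<close> are bounded without any condition on \<open>w\<close>.\<close>

lemma dual_form:
  assumes [measurable]: "\<phi> \<in> borel_measurable M"
  shows "(\<integral>\<^sup>+x. vmax_q n x * (\<phi> x * w x) \<partial>M)
    \<le> C * K epowr q * (\<integral>\<^sup>+x. g x epowr p * w x \<partial>M) epowr (q / p) *
      (\<integral>\<^sup>+x. \<phi> x epowr (p / (p - q)) * w x \<partial>M) epowr (1 - q / p)"
proof -
  define u where "u = p / (p - q)"
  have u: "1 < u" "u * (1 - q / p) = 1" using p q by (auto simp: u_def field_simps)
  have qp: "0 < q / p" "q / p < 1" using p q by (auto simp: field_simps)
  let ?P = "ennreal (p / (p - 1)) epowr p" and ?U = "ennreal (u / (u - 1)) epowr u"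
  have [measurable]: "S.mx n h \<in> borel_measurable M" "W.mx n \<phi> \<in> borel_measurable M"
    using S.measurable_mx[of n h] W.measurable_mx[of n \<phi>] by simp_all
  have "(\<integral>\<^sup>+x. S.mx n h x epowr q * W.mx n \<phi> x * w x epowr \<gamma> \<partial>M)
    = (\<integral>\<^sup>+x. (S.mx n h x epowr p * \<sigma> x) epowr (q / p) * (W.mx n \<phi> x epowr u * w x) epowr (1 - q / p) \<partial>M)"
  proof (rule nn_integral_cong)
    fix x
    have "- 1 / (p - 1) * (q / p) + (1 - q / p) = \<gamma>"
      using p q by (simp add: \<gamma>_def divide_simps) (simp add: algebra_simps)
    then have e1: "w x epowr \<gamma> = \<sigma> x epowr (q / p) * w x epowr (1 - q / p)"
      by (simp add: \<sigma>_def epowr_epowr w_epowr_add)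
    have e2: "(S.mx n h x epowr p) epowr (q / p) = S.mx n h x epowr q"
      "(W.mx n \<phi> x epowr u) epowr (1 - q / p) = W.mx n \<phi> x"
      using p q u(2) by (auto simp: epowr_epowr)
    show "S.mx n h x epowr q * W.mx n \<phi> x * w x epowr \<gamma>
      = (S.mx n h x epowr p * \<sigma> x) epowr (q / p) * (W.mx n \<phi> x epowr u * w x) epowr (1 - q / p)"
      using qp by (simp add: epowr_mult e1 e2) (simp add: mult_ac)
  qed
  also have "\<dots> \<le> (\<integral>\<^sup>+x. S.mx n h x epowr p * \<sigma> x \<partial>M) epowr (q / p) *
      (\<integral>\<^sup>+x. W.mx n \<phi> x epowr u * w x \<partial>M) epowr (1 - q / p)"
    by (rule nn_integral_Holder) (use qp in auto)
  also have "\<dots> \<le> (?P * (\<integral>\<^sup>+x. g x epowr p * w x \<partial>M)) epowr (q / p) *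
      (?U * (\<integral>\<^sup>+x. \<phi> x epowr u * w x \<partial>M)) epowr (1 - q / p)"
  proof (intro mult_mono epowr_mono)
    have "h x epowr p * \<sigma> x = g x epowr p * w x" for x
    proof -
      have "1 / (p - 1) * p + - 1 / (p - 1) = 1" using p q by (simp add: divide_simps)
      then have "(w x epowr (1 / (p - 1))) epowr p * \<sigma> x = w x"
        by (simp add: \<sigma>_def epowr_epowr w_epowr_add)
      then show ?thesis using p q by (simp add: h_def epowr_mult mult.assoc)
    qed
    then show "(\<integral>\<^sup>+x. S.mx n h x epowr p * \<sigma> x \<partial>M) \<le> ?P * (\<integral>\<^sup>+x. g x epowr p * w x \<partial>M)"
      using S.Doob[of p h n] p q by (simp add: nn_integral_density mult.commute)
    show "(\<integral>\<^sup>+x. W.mx n \<phi> x epowr u * w x \<partial>M) \<le> ?U * (\<integral>\<^sup>+x. \<phi> x epowr u * w x \<partial>M)"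
      using W.Doob[of u \<phi> n] u by (simp add: nn_integral_density mult.commute)
  qed (use qp in auto)
  also have "\<dots> = (?P epowr (q / p) * ?U epowr (1 - q / p)) *
      ((\<integral>\<^sup>+x. g x epowr p * w x \<partial>M) epowr (q / p) * (\<integral>\<^sup>+x. \<phi> x epowr u * w x \<partial>M) epowr (1 - q / p))"
    using qp by (simp add: epowr_mult mult_ac)
  finally have le: "(\<integral>\<^sup>+x. S.mx n h x epowr q * W.mx n \<phi> x * w x epowr \<gamma> \<partial>M) \<le> \<dots>" .
  have "(\<integral>\<^sup>+x. vmax_q n x * (\<phi> x * w x) \<partial>M)
    \<le> A epowr q * (K epowr q * 2 epowr (1 + s)) *
      (\<integral>\<^sup>+x. S.mx n h x epowr q * W.mx n \<phi> x * w x epowr \<gamma> \<partial>M)"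
    by (rule dual_form_pre) simp
  also have "\<dots> \<le> A epowr q * (K epowr q * 2 epowr (1 + s)) *
      ((?P epowr (q / p) * ?U epowr (1 - q / p)) *
      ((\<integral>\<^sup>+x. g x epowr p * w x \<partial>M) epowr (q / p) * (\<integral>\<^sup>+x. \<phi> x epowr u * w x \<partial>M) epowr (1 - q / p)))"
    by (rule mult_left_mono[OF le]) simp
  also have "\<dots> = C * K epowr q * (\<integral>\<^sup>+x. g x epowr p * w x \<partial>M) epowr (q / p) *
      (\<integral>\<^sup>+x. \<phi> x epowr u * w x \<partial>M) epowr (1 - q / p)"
    unfolding C_def u_def[symmetric] by (simp only: mult_ac)
  finally show ?thesis unfolding u_def .
qed

text \<open>Apply \<open>dual_form\<close> to the power \<open>p/q - 1\<close> of the maximal function itself. Truncating it in size and to a set of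
  finite weight makes the left-hand side finite, so that it can be absorbed; monotone convergence
  removes the truncation.\<close>

theorem dyadic_bound:
  "(\<integral>\<^sup>+x. vmax_q n x epowr (p / q) * w x \<partial>M) \<le> (C * K epowr q) epowr (p / q) * (\<integral>\<^sup>+x. g x epowr p * w x \<partial>M)"
proof -
  have pq: "1 < p / q" "1 / (p / q) = q / p" using p q by (auto simp: field_simps)
  have "sigma_finite_measure (density M w)"
  proof
    show "\<exists>A. countable A \<and> A \<subseteq> sets (density M w) \<and> \<Union> A = space (density M w) \<and>
        (\<forall>a\<in>A. emeasure (density M w) a \<noteq> \<infinity>)"
      using countable_cells[of 0] W.cell_finite[of 0]
      by (intro exI[of _ "range (cell 0)"]) (auto simp: less_top[symmetric])
  qed
  then obtain B :: "nat \<Rightarrow> 'a set" where B: "range B \<subseteq> sets M" "(\<Union>i. B i) = UNIV"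
    "\<And>i. emeasure (density M w) (B i) \<noteq> \<infinity>" "incseq B"
    using sigma_finite_measure.sigma_finite_incseq[of "density M w"] by (metis sets_density space_density space_M)
  have Bs [measurable]: "B j \<in> sets M" for j using B(1) by auto
  define Y where "Y j x = min (vmax_q n x) (of_nat j) epowr (p / q) * indicator (B j) x * w x" for j x
  have [measurable]: "Y j \<in> borel_measurable M" for j unfolding Y_def by measurable
  have "(\<integral>\<^sup>+x. Y j x \<partial>M) \<le> (C * K epowr q) epowr (p / q) * (\<integral>\<^sup>+x. g x epowr p * w x \<partial>M)" for j
  proof (rule absorb_power[OF pq(1)])
    define \<phi> where "\<phi> x = min (vmax_q n x) (of_nat j) epowr (p / q - 1) * indicator (B j) x" for x
    have [measurable]: "\<phi> \<in> borel_measurable M" unfolding \<phi>_def by measurable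
    have "(p / q - 1) * (p / (p - q)) = p / q" using p q by (simp add: field_simps)
    then have "\<phi> x epowr (p / (p - q)) * w x = Y j x" for x
      using p q by (auto simp: \<phi>_def Y_def indicator_def epowr_epowr)
    moreover have "Y j x \<le> vmax_q n x * (\<phi> x * w x)" for x
    proof -
      have "min (vmax_q n x) (of_nat j) epowr (p / q) = min (vmax_q n x) (of_nat j) * min (vmax_q n x) (of_nat j) epowr (p / q - 1)"
        using epowr_add[of 1 "p / q - 1" "min (vmax_q n x) (of_nat j)"] pq(1) by simp
      also have "\<dots> \<le> vmax_q n x * min (vmax_q n x) (of_nat j) epowr (p / q - 1)"
        by (intro mult_right_mono) auto
      finally show ?thesis by (simp add: Y_def \<phi>_def indicator_def mult.assoc[symmetric] mult_right_mono)
    qed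
    then have "(\<integral>\<^sup>+x. Y j x \<partial>M) \<le> (\<integral>\<^sup>+x. vmax_q n x * (\<phi> x * w x) \<partial>M)" by (rule nn_integral_mono)
    ultimately show "(\<integral>\<^sup>+x. Y j x \<partial>M) \<le> C * K epowr q * (\<integral>\<^sup>+x. g x epowr p * w x \<partial>M) epowr (1 / (p / q)) *
        (\<integral>\<^sup>+x. Y j x \<partial>M) epowr (1 - 1 / (p / q))"
      using dual_form[of \<phi> n] unfolding pq(2) by simp
    have "(\<integral>\<^sup>+x. Y j x \<partial>M) \<le> (\<integral>\<^sup>+x. of_nat j epowr (p / q) * (w x * indicator (B j) x) \<partial>M)"
    proof (rule nn_integral_mono)
      fix x
      have "min (vmax_q n x) (of_nat j) epowr (p / q) \<le> of_nat j epowr (p / q)"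
        using pq(1) by (intro epowr_mono) auto
      then show "Y j x \<le> of_nat j epowr (p / q) * (w x * indicator (B j) x)"
        by (simp add: Y_def indicator_def mult_right_mono)
    qed
    also have "\<dots> = of_nat j epowr (p / q) * emeasure (density M w) (B j)"
      by (simp add: nn_integral_cmult emeasure_density)
    also have "\<dots> < top"
      using B(3)[of j] pq(1) epowr_top_iff[of "p / q" "of_nat j"]
      by (auto simp: ennreal_mult_less_top less_top)
    finally show "(\<integral>\<^sup>+x. Y j x \<partial>M) < top" .
  qed
  then have bound: "(SUP j. \<integral>\<^sup>+x. Y j x \<partial>M) \<le> (C * K epowr q) epowr (p / q) * (\<integral>\<^sup>+x. g x epowr p * w x \<partial>M)"
    by (rule SUP_least)
  have "incseq Y"
    unfolding Y_def[abs_def] using B(4) pq(1)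
    by (auto simp: incseq_def le_fun_def indicator_def intro!: mult_right_mono epowr_mono min.mono)
  then have conv: "(SUP j. \<integral>\<^sup>+x. Y j x \<partial>M) = (\<integral>\<^sup>+x. (SUP j. Y j x) \<partial>M)"
    by (intro nn_integral_monotone_convergence_SUP[symmetric]) auto
  have "vmax_q n x epowr (p / q) * w x \<le> (SUP j. Y j x)" for x
  proof -
    obtain j0 where j0: "x \<in> B j0" using B(2) by auto
    have "vmax_q n x = (SUP j. min (vmax_q n x) (of_nat j))"
    proof -
      have "(SUP j. min (vmax_q n x) (of_nat j)) = min (vmax_q n x) (SUP j. of_nat j)"
        using inf_SUP[of "vmax_q n x" of_nat UNIV] by (simp add: inf_min)
      then show ?thesis by (simp add: ennreal_SUP_of_nat_eq_top)
    qed
    then have "vmax_q n x epowr (p / q) * w x = (SUP j. min (vmax_q n x) (of_nat j) epowr (p / q)) * w x"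
      using SUP_epowr[of "p / q" "\<lambda>j. min (vmax_q n x) (of_nat j)" UNIV] pq(1) by simp
    also have "\<dots> = (SUP j. min (vmax_q n x) (of_nat j) epowr (p / q) * w x)"
      by (rule SUP_mult_right_ennreal)
    also have "\<dots> \<le> (SUP j. Y j x)"
    proof (rule SUP_least)
      fix j
      have "x \<in> B (max j j0)" using j0 incseqD[OF B(4), of j0 "max j j0"] by auto
      then have "min (vmax_q n x) (of_nat j) epowr (p / q) * w x \<le> Y (max j j0) x"
        unfolding Y_def using pq(1) by (auto intro!: mult_right_mono epowr_mono min.mono)
      then show "min (vmax_q n x) (of_nat j) epowr (p / q) * w x \<le> (SUP j. Y j x)"
        by (rule SUP_upper2[OF UNIV_I])
    qed
    finally show ?thesis .
  qed
  then have "(\<integral>\<^sup>+x. vmax_q n x epowr (p / q) * w x \<partial>M) \<le> (\<integral>\<^sup>+x. (SUP j. Y j x) \<partial>M)"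
    by (rule nn_integral_mono)
  with bound show ?thesis unfolding conv by (rule order_trans[rotated])
qed

lemma C_finite: "C < top"
proof -
  have "A < top" unfolding A_def by (simp add: ennreal_mult_less_top)
  then have "A epowr q < top" using q by (simp add: epowr_top_iff less_top[symmetric])
  moreover have "2 epowr (1 + s) < top" using epowr_finite_pos[of 2] by simp
  moreover have "0 < 1 - q / p" "0 < q / p" "0 < p" "0 < p / (p - q)" using p q by (auto simp: field_simps)
  then have "(ennreal a epowr p) epowr (q / p) < top" "(ennreal a epowr (p / (p - q))) epowr (1 - q / p) < top" for a
    by (simp_all add: less_top[symmetric] epowr_top_iff)
  ultimately show ?thesis unfolding C_def by (simp add: ennreal_mult_less_top)
qed

end

section \<open>Dyadic grids in Euclidean space\<close>

text \<open>The half-open cube of side \<open>L / 2 ^ k\<close> containing \<open>x\<close> in the dyadic grid with origin \<open>b\<close>. The largest side is \<open>L\<close>, because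
  generations are counted from \<open>0\<close>.\<close>

definition grid_cell :: "real \<Rightarrow> real ^ 'n \<Rightarrow> nat \<Rightarrow> real ^ 'n \<Rightarrow> (real ^ 'n) set" where
  "grid_cell L b k x = {y. \<forall>i. \<lfloor>(y $ i - b $ i) / (L / 2 ^ k)\<rfloor> = \<lfloor>(x $ i - b $ i) / (L / 2 ^ k)\<rfloor>}"

definition grid_corner :: "real \<Rightarrow> real ^ 'n \<Rightarrow> nat \<Rightarrow> real ^ 'n \<Rightarrow> real ^ 'n" where
  "grid_corner L b k x = (\<chi> i. b $ i + of_int \<lfloor>(x $ i - b $ i) / (L / 2 ^ k)\<rfloor> * (L / 2 ^ k))"

definition closed_cube :: "real ^ 'n \<Rightarrow> real \<Rightarrow> (real ^ 'n) set" where
  "closed_cube a l = cbox a (\<chi> i. a $ i + l)"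

lemma cubes_eq: "cubes = {closed_cube a l | a l. l > 0}"
  by (simp add: cubes_def closed_cube_def)

lemma mem_closed_cube: "y \<in> closed_cube a l \<longleftrightarrow> (\<forall>i. a $ i \<le> y $ i \<and> y $ i \<le> a $ i + l)"
  by (simp add: closed_cube_def mem_box_cart)

lemma emeasure_closed_cube:
  fixes a :: "real ^ 'n"
  assumes "0 \<le> l"
  shows "emeasure lebesgue (closed_cube a l) = ennreal (l ^ CARD('n))"
proof -
  have ne: "closed_cube a l \<noteq> {}" using assms by (auto simp: mem_closed_cube intro!: exI[of _ a] simp: set_eq_iff)
  have "emeasure lebesgue (closed_cube a l) = ennreal (measure lborel (closed_cube a l))"
    unfolding closed_cube_def using emeasure_lborel_cbox_finite[of a "\<chi> i. a $ i + l"]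
    by (simp add: emeasure_eq_ennreal_measure)
  also have "measure lborel (closed_cube a l) = l ^ CARD('n)"
    using ne unfolding closed_cube_def by (subst content_cbox_cart) auto
  finally show ?thesis .
qed

lemma closed_cube_sets [measurable]: "closed_cube a l \<in> sets lebesgue"
  by (simp add: closed_cube_def)

lemma mem_grid_cell:
  assumes L: "0 < L"
  shows "y \<in> grid_cell L b k x \<longleftrightarrow>
    (\<forall>i. grid_corner L b k x $ i \<le> y $ i \<and> y $ i < grid_corner L b k x $ i + L / 2 ^ k)"
proof -
  have "\<lfloor>(z - c) / d\<rfloor> = m \<longleftrightarrow> c + of_int m * d \<le> z \<and> z < c + of_int m * d + d"
    if "0 < d" for z c d :: real and m
    unfolding floor_eq_iff using that by (auto simp: field_simps)
  from this[of "L / 2 ^ k"] L show ?thesis by (simp add: grid_cell_def grid_corner_def)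
qed

text \<open>The cells are half-open and the cubes of the theorem are closed; averages do not see the difference.\<close>

lemma grid_cell_AE:
  assumes L: "0 < L"
  shows "AE y in lebesgue. y \<in> grid_cell L b k x \<longleftrightarrow> y \<in> closed_cube (grid_corner L b k x) (L / 2 ^ k)"
proof (rule AE_I')
  let ?a = "grid_corner L b k x"
  let ?b = "\<chi> i. ?a $ i + L / 2 ^ k"
  show "cbox ?a ?b - box ?a ?b \<in> null_sets lebesgue"
    using negligible_frontier_interval[of ?a ?b] by (simp add: negligible_iff_null_sets)
  show "{y \<in> space lebesgue. \<not> (y \<in> grid_cell L b k x \<longleftrightarrow> y \<in> closed_cube ?a (L / 2 ^ k))}
      \<subseteq> cbox ?a ?b - box ?a ?b"
    unfolding mem_grid_cell[OF L] mem_closed_cube by (auto simp: mem_box_cart less_imp_le)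
qed

lemma grid_cell_sets:
  fixes b x :: "real ^ 'n"
  assumes L: "0 < L"
  shows "grid_cell L b k x \<in> sets lebesgue"
proof -
  have [measurable]: "(\<lambda>y :: real ^ 'n. y $ i) \<in> borel_measurable lebesgue" for i
    by (intro measurable_completion borel_measurable_continuous_onI continuous_intros) simp
  have "{y \<in> space lebesgue. \<forall>i\<in>UNIV. grid_corner L b k x $ i \<le> y $ i \<and> y $ i < grid_corner L b k x $ i + L / 2 ^ k}
      \<in> sets lebesgue"
    by measurable
  also have "{y \<in> space lebesgue. \<forall>i\<in>UNIV. grid_corner L b k x $ i \<le> y $ i \<and> y $ i < grid_corner L b k x $ i + L / 2 ^ k}
      = grid_cell L b k x"
    using mem_grid_cell[OF L] by auto
  finally show ?thesis .
qed

lemma grid_filtration: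
  fixes b :: "real ^ 'n"
  assumes L: "0 < L"
  shows "filtration (grid_cell L b)"
proof
  fix k and x y :: "real ^ 'n"
  show "x \<in> grid_cell L b k x" by (simp add: grid_cell_def)
  show "grid_cell L b k y = grid_cell L b k x" if "y \<in> grid_cell L b k x"
    using that by (auto simp: grid_cell_def)
  have half: "\<lfloor>z / (L / 2 ^ k)\<rfloor> = \<lfloor>z / (L / 2 ^ Suc k)\<rfloor> div 2" for z
  proof -
    have "z / (L / 2 ^ k) = (z / (L / 2 ^ Suc k)) / of_int 2" by simp
    then show ?thesis using floor_divide_real_eq_div[of 2 "z / (L / 2 ^ Suc k)"] by simp
  qed
  show "grid_cell L b (Suc k) x \<subseteq> grid_cell L b k x"
    unfolding grid_cell_def half by auto
  let ?g = "\<lambda>v :: int ^ 'n. {y :: real ^ 'n. \<forall>i. \<lfloor>(y $ i - b $ i) / (L / 2 ^ k)\<rfloor> = v $ i}"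
  have "range (grid_cell L b k) \<subseteq> range ?g"
  proof (rule image_subsetI)
    fix x
    have "grid_cell L b k x = ?g (\<chi> i. \<lfloor>(x $ i - b $ i) / (L / 2 ^ k)\<rfloor>)"
      by (simp add: grid_cell_def)
    then show "grid_cell L b k x \<in> range ?g" by blast
  qed
  then show "countable (range (grid_cell L b k))"
    by (rule countable_subset) simp
qed

lemma emeasure_grid_cell:
  fixes b x :: "real ^ 'n"
  assumes L: "0 < L"
  shows "emeasure lebesgue (grid_cell L b k x) = ennreal ((L / 2 ^ k) ^ CARD('n))"
proof -
  have "emeasure lebesgue (grid_cell L b k x) = emeasure lebesgue (closed_cube (grid_corner L b k x) (L / 2 ^ k))"
    using grid_cell_AE[OF L, of b k x] grid_cell_sets[OF L] by (intro emeasure_eq_AE) auto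
  also have "\<dots> = ennreal ((L / 2 ^ k) ^ CARD('n))" using L by (intro emeasure_closed_cube) simp
  finally show ?thesis .
qed

lemma grid_measured_filtration:
  assumes L: "0 < L"
  shows "measured_filtration (grid_cell L b) lebesgue"
proof -
  interpret filtration "grid_cell L b" by (rule grid_filtration[OF L])
  show ?thesis
    by unfold_locales (use L in \<open>auto simp: grid_cell_sets emeasure_grid_cell simp del: emeasure_completion\<close>)
qed

lemma grid_average:
  assumes L: "0 < L"
  shows "\<exists>Q\<in>cubes. \<forall>h. measured_filtration.E (grid_cell L b) lebesgue k h x = average Q h"
proof -
  interpret measured_filtration "grid_cell L b" lebesgue by (rule grid_measured_filtration[OF L])
  let ?Q = "closed_cube (grid_corner L b k x) (L / 2 ^ k)"
  have "(\<integral>\<^sup>+y\<in>grid_cell L b k x. h y \<partial>lebesgue) = (\<integral>\<^sup>+y\<in>?Q. h y \<partial>lebesgue)" for h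
    using grid_cell_AE[OF L, of b k x] by (intro nn_integral_cong_AE) (auto simp: indicator_def elim: eventually_mono)
  moreover have "?Q \<in> cubes" using L unfolding cubes_eq by (auto intro!: exI[of _ "L / 2 ^ k"])
  ultimately show ?thesis
    using L by (intro bexI[of _ ?Q]) (simp_all add: E_def average_def emeasure_grid_cell emeasure_closed_cube del: emeasure_completion)
qed

definition shift :: "real \<Rightarrow> 'n set \<Rightarrow> real ^ 'n" where
  "shift L T = (\<chi> i. if i \<in> T then L / 3 else 0)"

text \<open>The end points of the grid of mesh \<open>d = L / 2 ^ k\<close> and of its translate by \<open>L / 3\<close> are at least \<open>d / 3\<close> apart, because
  \<open>2 ^ k\<close> is not divisible by \<open>3\<close>. Translating by a fraction of the largest side \<open>L\<close> makes this hold
  for all generations at once.\<close>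

lemma no_common_endpoint:
  fixes L :: real
  assumes L: "0 < L" and l: "3 * l < L / 2 ^ k"
    and m: "u \<le> of_int m * (L / 2 ^ k)" "of_int m * (L / 2 ^ k) \<le> u + l"
    and m': "u \<le> L / 3 + of_int m' * (L / 2 ^ k)" "L / 3 + of_int m' * (L / 2 ^ k) \<le> u + l"
  shows False
proof -
  define d where "d = L / 2 ^ k"
  have d: "0 < d" "L = d * 2 ^ k" using L by (auto simp: d_def)
  have "\<bar>of_int m * d - of_int m' * d - L / 3\<bar> \<le> l"
    using m m' unfolding d_def[symmetric] by linarith
  moreover have "\<bar>3 * z\<bar> = 3 * \<bar>z\<bar>" for z :: real by (simp add: abs_mult)
  ultimately have "\<bar>3 * (of_int m * d - of_int m' * d - L / 3)\<bar> < d"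
    using l unfolding d_def[symmetric] by (metis le_less_trans mult_left_mono zero_le_numeral)
  moreover have "3 * (of_int m * d - of_int m' * d - L / 3) = d * of_int (3 * (m - m') - 2 ^ k)"
    by (simp add: d(2) algebra_simps)
  ultimately have "d * \<bar>of_int (3 * (m - m') - 2 ^ k)\<bar> < d * 1"
    using d(1) by (simp add: abs_mult)
  then have "\<bar>of_int (3 * (m - m') - 2 ^ k) :: real\<bar> < 1"
    using d(1) by (simp only: mult_less_cancel_left_pos)
  then have "3 * (m - m') = 2 ^ k" by linarith
  then have "3 dvd (2 ^ k :: int)" by (metis dvd_triv_left)
  then have "3 dvd (2 :: int)" by (rule prime_dvd_power[rotated]) simp
  then show False by simp
qed

lemma floor_neq_endpoint:
  assumes d: "0 < (d :: real)" and "u \<le> v" and ne: "\<lfloor>(u - c) / d\<rfloor> \<noteq> \<lfloor>(v - c) / d\<rfloor>"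
  shows "\<exists>m. u \<le> c + of_int m * d \<and> c + of_int m * d \<le> v"
proof -
  let ?m = "\<lfloor>(v - c) / d\<rfloor>"
  have "\<lfloor>(u - c) / d\<rfloor> \<le> ?m" using assms by (intro floor_mono divide_right_mono) auto
  with ne have "\<lfloor>(u - c) / d\<rfloor> < ?m" by simp
  then have "(u - c) / d < of_int ?m" by (simp add: floor_less_iff)
  moreover have "of_int ?m \<le> (v - c) / d" by simp
  ultimately show ?thesis using d by (intro exI[of _ ?m]) (simp add: less_divide_eq divide_less_eq le_divide_eq algebra_simps)
qed

text \<open>In each coordinate the short interval misses the end points of the grid or those of its translate, so
  the translation can be chosen coordinate by coordinate.\<close>

lemma one_third_trick:
  fixes a :: "real ^ 'n"
  assumes L: "0 < L" and l: "0 \<le> l" "3 * l < L / 2 ^ k"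
  shows "\<exists>T. \<forall>x\<in>closed_cube a l. closed_cube a l \<subseteq> grid_cell L (shift L T) k x"
proof -
  define T where "T = {i. \<exists>m::int. a $ i \<le> of_int m * (L / 2 ^ k) \<and> of_int m * (L / 2 ^ k) \<le> a $ i + l}"
  have eq: "\<lfloor>(a $ i - shift L T $ i) / (L / 2 ^ k)\<rfloor> = \<lfloor>(y $ i - shift L T $ i) / (L / 2 ^ k)\<rfloor>"
    if y: "y \<in> closed_cube a l" for y i
  proof (rule ccontr)
    assume ne: "\<not> ?thesis"
    have yi: "a $ i \<le> y $ i" "y $ i \<le> a $ i + l" using y by (auto simp: mem_closed_cube)
    have d: "0 < L / 2 ^ k" using L by simp
    obtain m where m: "a $ i \<le> shift L T $ i + of_int m * (L / 2 ^ k)" "shift L T $ i + of_int m * (L / 2 ^ k) \<le> y $ i"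
      using floor_neq_endpoint[OF d yi(1) ne] by auto
    show False
    proof (cases "i \<in> T")
      case True
      then obtain m' :: int where "a $ i \<le> of_int m' * (L / 2 ^ k)" "of_int m' * (L / 2 ^ k) \<le> a $ i + l"
        by (auto simp: T_def)
      then show False using no_common_endpoint[OF L l(2), of "a $ i" m' m] m True yi
        by (simp add: shift_def)
    next
      case False
      then have "shift L T $ i = 0" by (simp add: shift_def)
      with m yi have "a $ i \<le> of_int m * (L / 2 ^ k)" "of_int m * (L / 2 ^ k) \<le> a $ i + l" by simp_all
      then have "i \<in> T" unfolding T_def by blast
      with False show False by simp
    qed
  qed
  have "y \<in> grid_cell L (shift L T) k x" if "x \<in> closed_cube a l" "y \<in> closed_cube a l" for x y
    unfolding grid_cell_def using eq[OF that(1)] eq[OF that(2)] by (simp del: divide_divide_eq_right)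
  then show ?thesis by blast
qed

section \<open>From dyadic grids to the maximal operator\<close>

text \<open>Only cubes with side between \<open>1 / 2 ^ N\<close> and \<open>2 ^ N\<close> are admitted; they are covered by finitely many generations
  of grid cells.\<close>

definition trunc_maximal :: "nat \<Rightarrow> (real ^ 'n \<Rightarrow> ennreal) \<Rightarrow> real ^ 'n \<Rightarrow> ennreal" where
  "trunc_maximal N h x =
    (SUP Q\<in>{closed_cube a l | a l. 1 / 2 ^ N \<le> l \<and> l \<le> 2 ^ N \<and> x \<in> closed_cube a l}. average Q h)"

lemma trunc_maximal_mono: "N \<le> N' \<Longrightarrow> trunc_maximal N h x \<le> trunc_maximal N' h x"
  unfolding trunc_maximal_def
proof (rule SUP_subset_mono)
  assume N: "N \<le> N'"
  have "(1 :: real) / 2 ^ N' \<le> 1 / 2 ^ N" "(2 :: real) ^ N \<le> 2 ^ N'"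
    using N by (auto intro!: divide_left_mono power_increasing)
  note le = this
  show "{closed_cube a l | a l. 1 / 2 ^ N \<le> l \<and> l \<le> 2 ^ N \<and> x \<in> closed_cube a l}
      \<subseteq> {closed_cube a l | a l. 1 / 2 ^ N' \<le> l \<and> l \<le> 2 ^ N' \<and> x \<in> closed_cube a l}"
  proof clarify
    fix a l assume l: "1 / 2 ^ N \<le> l" "l \<le> 2 ^ N" and x: "x \<in> closed_cube a l"
    have "1 / 2 ^ N' \<le> l" "l \<le> 2 ^ N'" using l le by linarith+
    with x show "\<exists>a' l'. closed_cube a l = closed_cube a' l' \<and> 1 / 2 ^ N' \<le> l' \<and> l' \<le> 2 ^ N' \<and> x \<in> closed_cube a' l'"
      by (intro exI[of _ a] exI[of _ l] conjI refl)
  qed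
qed simp

lemma maximal_le_SUP_trunc:
  fixes x :: "real ^ 'n"
  shows "maximal u x \<le> (SUP N. trunc_maximal N (\<lambda>y. ennreal \<bar>u y\<bar>) x)"
  unfolding maximal_def
proof (rule SUP_least)
  fix Q :: "(real ^ 'n) set" assume "Q \<in> {Q \<in> cubes. x \<in> Q}"
  then obtain a l where Q: "Q = closed_cube a l" "0 < l" "x \<in> Q" by (auto simp: cubes_eq)
  obtain N1 :: nat where N1: "1 / l < 2 ^ N1" using real_arch_pow[of 2 "1 / l"] by auto
  obtain N2 :: nat where N2: "l < 2 ^ N2" using real_arch_pow[of 2 l] by auto
  let ?N = "max N1 N2"
  have "(2 :: real) ^ N1 \<le> 2 ^ ?N" "(2 :: real) ^ N2 \<le> 2 ^ ?N" by (auto intro!: power_increasing)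
  then have "1 / l \<le> 2 ^ ?N" "l \<le> 2 ^ ?N" using N1 N2 by linarith+
  then have "1 / 2 ^ ?N \<le> l" using Q(2) by (simp add: field_simps)
  with \<open>l \<le> 2 ^ ?N\<close> Q have "average Q (\<lambda>y. ennreal \<bar>u y\<bar>) \<le> trunc_maximal ?N (\<lambda>y. ennreal \<bar>u y\<bar>) x"
    unfolding trunc_maximal_def by (intro SUP_upper) blast
  also have "\<dots> \<le> (SUP N. trunc_maximal N (\<lambda>y. ennreal \<bar>u y\<bar>) x)" by (intro SUP_upper) simp
  finally show "average Q (\<lambda>y. ennreal \<bar>u y\<bar>) \<le> \<dots>" .
qed

text \<open>Take the first generation whose cells are at most six times as long as the given cube. The cells of the generation
  before it are more than six times as long, so its own are more than three times as long.\<close>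

lemma scale_exists:
  fixes l :: real
  assumes l: "1 / 2 ^ N \<le> l" "l \<le> 2 ^ N"
  shows "\<exists>k\<le>2 * N + 3. 3 * l < 8 * 2 ^ N / 2 ^ k \<and> 8 * 2 ^ N / 2 ^ k \<le> 6 * l"
proof -
  define P where "P k \<longleftrightarrow> 8 * 2 ^ N / 2 ^ k \<le> 6 * l" for k
  have l0: "0 < l" using l(1) by (rule less_le_trans[rotated]) simp
  have "(2 :: real) ^ (2 * N + 3) = 2 ^ N * 2 ^ N * 8"
    by (simp only: power_add power_even_eq power2_eq_square) simp
  then have "8 * 2 ^ N / 2 ^ (2 * N + 3) = (1 :: real) / 2 ^ N" by simp
  then have PN: "P (2 * N + 3)" unfolding P_def using l(1) l0 by linarith
  define k where "k = (LEAST k. P k)"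
  have Pk: "P k" unfolding k_def by (rule LeastI[of P, OF PN])
  have kN: "k \<le> 2 * N + 3" unfolding k_def by (rule Least_le[of P, OF PN])
  have "3 * l < 8 * 2 ^ N / 2 ^ k"
  proof (cases k)
    case 0
    have "(0 :: real) < 2 ^ N" by simp
    with l(2) have "3 * l < 8 * 2 ^ N" by linarith
    with 0 show ?thesis by simp
  next
    case (Suc j)
    then have "\<not> P j" using not_less_Least[of j P] by (simp add: k_def)
    with Suc show ?thesis by (simp add: P_def field_simps)
  qed
  with Pk kN show ?thesis by (auto simp: P_def)
qed

lemma trunc_maximal_le_grids:
  fixes x :: "real ^ 'n"
  shows "trunc_maximal N h x \<le> ennreal (6 ^ CARD('n)) *
    (SUP T. measured_filtration.mx (grid_cell (8 * 2 ^ N) (shift (8 * 2 ^ N) T)) lebesgue (2 * N + 3) h x)"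
  unfolding trunc_maximal_def
proof (rule SUP_least)
  fix Q :: "(real ^ 'n) set"
  assume "Q \<in> {closed_cube a l | a l. 1 / 2 ^ N \<le> l \<and> l \<le> 2 ^ N \<and> x \<in> closed_cube a l}"
  then obtain a l where Q: "Q = closed_cube a l" and l: "1 / 2 ^ N \<le> l" "l \<le> 2 ^ N" and x: "x \<in> Q" by auto
  have l0: "0 < l" using l(1) by (rule less_le_trans[rotated]) simp
  define L :: real where "L = 8 * 2 ^ N"
  have L: "0 < L" by (simp add: L_def)
  obtain k where k: "k \<le> 2 * N + 3" "3 * l < L / 2 ^ k" "L / 2 ^ k \<le> 6 * l"
    using scale_exists[OF l] unfolding L_def by auto
  obtain T where T: "Q \<subseteq> grid_cell L (shift L T) k x"
    using one_third_trick[OF L less_imp_le[OF l0] k(2), of a] x Q by auto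
  interpret measured_filtration "grid_cell L (shift L T)" lebesgue by (rule grid_measured_filtration[OF L])
  have "(\<integral>\<^sup>+y\<in>Q. h y \<partial>lebesgue) \<le> (\<integral>\<^sup>+y\<in>grid_cell L (shift L T) k x. h y \<partial>lebesgue)"
    using T by (intro nn_integral_mono) (auto simp: indicator_def)
  also have "\<dots> = E k h x * ennreal ((L / 2 ^ k) ^ CARD('n))"
    by (simp only: E_cell[symmetric] emeasure_grid_cell[OF L])
  also have "\<dots> \<le> E k h x * ennreal ((6 * l) ^ CARD('n))"
    using k(3) L by (intro mult_left_mono ennreal_leI power_mono) auto
  also have "\<dots> = ennreal (l ^ CARD('n)) * (ennreal (6 ^ CARD('n)) * E k h x)"
    using l0 by (simp add: power_mult_distrib ennreal_mult mult_ac)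
  also have "ennreal (l ^ CARD('n)) = emeasure lebesgue Q"
    using l0 Q by (simp add: emeasure_closed_cube del: emeasure_completion)
  finally have "average Q h \<le> ennreal (6 ^ CARD('n)) * E k h x"
    unfolding average_def using l0 Q
    by (intro divide_le_posI_ennreal) (simp_all add: emeasure_closed_cube del: emeasure_completion)
  also have "E k h x \<le> mx (2 * N + 3) h x" by (rule E_le_mx[OF k(1)])
  also have "\<dots> \<le> (SUP T. measured_filtration.mx (grid_cell L (shift L T)) lebesgue (2 * N + 3) h x)"
    by (rule SUP_upper) simp
  finally show "average Q h \<le> ennreal (6 ^ CARD('n)) *
      (SUP T. measured_filtration.mx (grid_cell (8 * 2 ^ N) (shift (8 * 2 ^ N) T)) lebesgue (2 * N + 3) h x)"
    by (simp add: L_def mult_left_mono)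
qed

lemma finite_SUP_epowr_le_sum:
  fixes F :: "'t :: finite \<Rightarrow> ennreal"
  assumes "0 < q"
  shows "(SUP T. F T) epowr q \<le> (\<Sum>T\<in>UNIV. F T epowr q)"
  unfolding SUP_epowr[OF assms] by (intro SUP_least member_le_sum) auto

lemma suminf_SUP_incseq:
  fixes F :: "nat \<Rightarrow> nat \<Rightarrow> ennreal"
  assumes "\<And>i. incseq (\<lambda>N. F N i)"
  shows "(\<Sum>i. SUP N. F N i) = (SUP N. \<Sum>i. F N i)"
  using assms by (intro ennreal_suminf_SUP_eq) auto

text \<open>The factor lost in the passage from dyadic cells to all cubes: \<open>6 ^ n\<close> is the ratio of the volumes, and there are
  \<open>2 ^ n\<close> translated grids, indexed by the sets of translated coordinates.\<close>

definition grid_const :: "'n::finite itself \<Rightarrow> real \<Rightarrow> real \<Rightarrow> ennreal" where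
  "grid_const _ p q = (ennreal (6 ^ CARD('n)) epowr q) epowr (p / q) *
    (of_nat (CARD('n set)) epowr (p / q) * of_nat (CARD('n set)))"

abbreviation core_const :: "'n::finite itself \<Rightarrow> real \<Rightarrow> real \<Rightarrow> real \<Rightarrow> ennreal" where
  "core_const _ p q r \<equiv> weighted_filtration.C (2 ^ CARD('n)) q p r"

text \<open>The core of the theorem for weights that are positive and finite everywhere, so that powers of \<open>w\<close> with arbitrary
  exponents can be multiplied at every point. The general case reduces to this one by changing the weight on a null set.\<close>

locale positive_weight =
  fixes w :: "real ^ 'n \<Rightarrow> ennreal" and p q r :: real and K :: ennreal
  assumes w [measurable]: "w \<in> borel_measurable lebesgue"
    and w_pos: "\<And>x. 0 < w x" and w_fin: "\<And>x. w x < top"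
    and q: "1 < q" and p: "q + 1 < p" and r: "1 < r"
    and average_w: "\<And>Q. Q \<in> cubes \<Longrightarrow> average Q w < top"
    and average_dual: "\<And>Q. Q \<in> cubes \<Longrightarrow> average Q (\<lambda>y. w y epowr (- 1 / (p - 1))) < top"
    and K: "\<And>Q. Q \<in> cubes \<Longrightarrow>
      (average Q w * average Q (\<lambda>y. w y epowr (- 1 / (p - 1))) epowr (p - 1)) epowr (1 / (p - 1)) *
      (average Q w * average Q (\<lambda>y. w y epowr (- 1 / (r - 1))) epowr (r - 1)) epowr (1 / q - 1 / (p - 1)) \<le> K"
begin

lemma grid_weighted_filtration:
  assumes L: "0 < L" and f: "\<And>i. f i \<in> borel_measurable lebesgue"
  shows "weighted_filtration (grid_cell L b) lebesgue (2 ^ CARD('n)) q f w p r K"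
proof -
  interpret measured_filtration "grid_cell L b" lebesgue by (rule grid_measured_filtration[OF L])
  show ?thesis
  proof unfold_locales
    fix k x
    have "(L / 2 ^ k) ^ CARD('n) = 2 ^ CARD('n) * (L / 2 ^ Suc k) ^ CARD('n)"
      by (simp add: power_mult_distrib[symmetric])
    then show "emeasure lebesgue (grid_cell L b k x)
        \<le> ennreal (2 ^ CARD('n)) * emeasure lebesgue (grid_cell L b (Suc k) x)"
      using L by (simp add: emeasure_grid_cell ennreal_mult[symmetric] del: emeasure_completion)
    obtain Q where Q: "Q \<in> cubes" "\<And>h. E k h x = average Q h"
      using grid_average[OF L, of b k x] by blast
    show "E k w x < top" "E k (\<lambda>y. w y epowr (- 1 / (p - 1))) x < top"
      "(E k w x * E k (\<lambda>y. w y epowr (- 1 / (p - 1))) x epowr (p - 1)) epowr (1 / (p - 1)) *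
       (E k w x * E k (\<lambda>y. w y epowr (- 1 / (r - 1))) x epowr (r - 1)) epowr (1 / q - 1 / (p - 1)) \<le> K"
      unfolding Q(2) using average_w[OF Q(1)] average_dual[OF Q(1)] K[OF Q(1)] by auto
  qed (use q p r w_pos w_fin f in auto)
qed

lemma core_const_finite: "core_const TYPE('n) p q r < top"
proof -
  interpret weighted_filtration "grid_cell 1 0" "lebesgue :: (real ^ 'n) measure" "2 ^ CARD('n)" q "\<lambda>_ _. 0" w p r K
    by (rule grid_weighted_filtration) auto
  show ?thesis by (rule C_finite)
qed

text \<open>A measurable majorant of the truncated maximal function. It is not monotone in \<open>N\<close>, since the grids change
  with \<open>N\<close>.\<close>

definition majorant :: "nat \<Rightarrow> (nat \<Rightarrow> real ^ 'n \<Rightarrow> ennreal) \<Rightarrow> real ^ 'n \<Rightarrow> ennreal" where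
  "majorant N f x = (ennreal (6 ^ CARD('n)) epowr q) epowr (p / q) * of_nat (CARD('n set)) epowr (p / q) *
    (\<Sum>T\<in>UNIV. weighted_filtration.vmax_q (grid_cell (8 * 2 ^ N) (shift (8 * 2 ^ N) T)) lebesgue q f (2 * N + 3) x
      epowr (p / q) * w x)"

lemma trunc_bound:
  fixes f :: "nat \<Rightarrow> real ^ 'n \<Rightarrow> ennreal"
  assumes f [measurable]: "\<And>i. f i \<in> borel_measurable lebesgue"
  shows "majorant N f \<in> borel_measurable lebesgue" (is ?meas)
    "(\<Sum>i. trunc_maximal N (f i) x epowr q) epowr (p / q) * w x \<le> majorant N f x" (is ?le)
    "(\<integral>\<^sup>+x. majorant N f x \<partial>lebesgue) \<le> grid_const TYPE('n) p q * ((core_const TYPE('n) p q r * K epowr q) epowr (p / q) *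
      (\<integral>\<^sup>+x. ((\<Sum>i. f i x epowr q) epowr (1 / q)) epowr p * w x \<partial>lebesgue))" (is ?int)
proof -
  let ?L = "8 * 2 ^ N :: real" and ?n = "2 * N + 3"
  let ?c = "ennreal (6 ^ CARD('n))" and ?d = "of_nat (CARD('n set)) :: ennreal"
  define G where "G T = weighted_filtration.vmax_q (grid_cell ?L (shift ?L T)) (lebesgue :: (real ^ 'n) measure) q f ?n" for T :: "'n set"
  have wf: "weighted_filtration (grid_cell ?L (shift ?L T)) lebesgue (2 ^ CARD('n)) q f w p r K" for T :: "'n set"
    by (rule grid_weighted_filtration) auto
  have G [measurable]: "G T \<in> borel_measurable lebesgue" for T
    unfolding G_def by (rule weighted_filtration.measurable_vmax_q[OF wf])
  have pq: "1 \<le> p / q" using p q by (simp add: field_simps)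
  have maj: "majorant N f x = (?c epowr q) epowr (p / q) * ?d epowr (p / q) * (\<Sum>T\<in>UNIV. G T x epowr (p / q) * w x)" for x
    by (simp only: majorant_def G_def)
  show ?meas unfolding maj[abs_def] by measurable
  show ?le
  proof -
    have "(\<Sum>i. trunc_maximal N (f i) x epowr q) \<le> (\<Sum>i. ?c epowr q *
      (\<Sum>T\<in>UNIV. measured_filtration.mx (grid_cell ?L (shift ?L T)) lebesgue ?n (f i) x epowr q))"
    proof (intro suminf_le)
      fix i
      have "trunc_maximal N (f i) x epowr q \<le> (?c * (SUP T. measured_filtration.mx (grid_cell ?L (shift ?L T)) lebesgue ?n (f i) x)) epowr q"
        using q by (intro epowr_mono trunc_maximal_le_grids) auto
      also have "\<dots> \<le> ?c epowr q * (\<Sum>T\<in>UNIV. measured_filtration.mx (grid_cell ?L (shift ?L T)) lebesgue ?n (f i) x epowr q)"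
        using q by (simp add: epowr_mult mult_left_mono finite_SUP_epowr_le_sum)
      finally show "trunc_maximal N (f i) x epowr q \<le> \<dots>" .
    qed auto
    also have "\<dots> = ?c epowr q * (\<Sum>T\<in>UNIV. G T x)"
      by (simp add: G_def weighted_filtration.vmax_q_def[OF wf] suminf_sum)
    finally have "(\<Sum>i. trunc_maximal N (f i) x epowr q) epowr (p / q) \<le> (?c epowr q * (\<Sum>T\<in>UNIV. G T x)) epowr (p / q)"
      using pq by (intro epowr_mono) auto
    also have "\<dots> \<le> (?c epowr q) epowr (p / q) * (?d epowr (p / q) * (\<Sum>T\<in>UNIV. G T x epowr (p / q)))"
      using pq sum_epowr_le[OF finite_class.finite_UNIV pq, of "\<lambda>T. G T x"]
      by (simp add: epowr_mult mult_left_mono)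
    finally have "(\<Sum>i. trunc_maximal N (f i) x epowr q) epowr (p / q) * w x
      \<le> (?c epowr q) epowr (p / q) * (?d epowr (p / q) * (\<Sum>T\<in>UNIV. G T x epowr (p / q))) * w x"
      by (rule mult_right_mono) simp
    then show ?thesis by (simp add: maj sum_distrib_right[symmetric] mult.assoc)
  qed
  let ?R = "(core_const TYPE('n) p q r * K epowr q) epowr (p / q) *
      (\<integral>\<^sup>+x. ((\<Sum>i. f i x epowr q) epowr (1 / q)) epowr p * w x \<partial>lebesgue)"
  have "(\<integral>\<^sup>+x. G T x epowr (p / q) * w x \<partial>lebesgue) \<le> ?R" for T
  proof -
    interpret weighted_filtration "grid_cell ?L (shift ?L T)" lebesgue "2 ^ CARD('n)" q f w p r K by (rule wf)
    show ?thesis using dyadic_bound[of ?n] by (simp add: G_def g_def[abs_def] epowr_epowr)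
  qed
  then have "(\<Sum>T\<in>UNIV. \<integral>\<^sup>+x. G T x epowr (p / q) * w x \<partial>lebesgue) \<le> ?d * ?R"
    by (intro sum_bounded_above) auto
  then have "(?c epowr q) epowr (p / q) * ?d epowr (p / q) * (\<Sum>T\<in>UNIV. \<integral>\<^sup>+x. G T x epowr (p / q) * w x \<partial>lebesgue)
      \<le> (?c epowr q) epowr (p / q) * ?d epowr (p / q) * (?d * ?R)"
    by (rule mult_left_mono) simp
  then show ?int
    unfolding maj grid_const_def by (simp add: nn_integral_cmult nn_integral_sum mult.assoc)
qed

text \<open>The truncated maximal functions increase to the maximal function and stay below the majorants, hence so does
  the limit below the lower limit of the majorants. Fatou's lemma takes the place of monotone
  convergence and spares the measurability of the maximal function.\<close>

theorem maximal_bound: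
  fixes f :: "nat \<Rightarrow> real ^ 'n \<Rightarrow> real"
  assumes f: "\<And>i. f i \<in> borel_measurable lebesgue"
  shows "(\<integral>\<^sup>+x. vector_maximal q f x epowr p * w x \<partial>lebesgue)
    \<le> grid_const TYPE('n) p q * ((core_const TYPE('n) p q r * K epowr q) epowr (p / q) *
      (\<integral>\<^sup>+x. lq_norm q (\<lambda>i. f i x) epowr p * w x \<partial>lebesgue))"
    (is "_ \<le> ?R")
proof -
  define F where "F i x = ennreal \<bar>f i x\<bar>" for i x
  have F: "F i \<in> borel_measurable lebesgue" for i using f unfolding F_def by measurable
  have q0: "0 < q" and pq: "0 < p / q" using p q by auto
  define U where "U N x = (\<Sum>i. trunc_maximal N (F i) x epowr q)" for N x
  have U_mono: "U N x \<le> U N' x" if "N \<le> N'" for N N' x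
    unfolding U_def using that q by (intro suminf_le epowr_mono trunc_maximal_mono) auto
  have R: "?R = grid_const TYPE('n) p q * ((core_const TYPE('n) p q r * K epowr q) epowr (p / q) *
      (\<integral>\<^sup>+x. ((\<Sum>i. F i x epowr q) epowr (1 / q)) epowr p * w x \<partial>lebesgue))"
    by (simp add: lq_norm_def F_def)
  have W: "majorant N F \<in> borel_measurable lebesgue" "U N x epowr (p / q) * w x \<le> majorant N F x"
      "(\<integral>\<^sup>+x. majorant N F x \<partial>lebesgue) \<le> ?R" for N x
    unfolding U_def R by (rule trunc_bound[OF F])+
  have "vector_maximal q f x epowr p * w x \<le> liminf (\<lambda>N. majorant N F x)" for x
  proof -
    have "(\<Sum>i. maximal (f i) x epowr q) \<le> (\<Sum>i. (SUP N. trunc_maximal N (F i) x) epowr q)"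
      using q unfolding F_def by (intro suminf_le epowr_mono maximal_le_SUP_trunc) auto
    also have "\<dots> = (\<Sum>i. SUP N. trunc_maximal N (F i) x epowr q)"
      by (simp add: SUP_epowr[OF q0])
    also have "\<dots> = (SUP N. U N x)"
      unfolding U_def using q
      by (intro suminf_SUP_incseq) (auto simp: incseq_def intro!: epowr_mono trunc_maximal_mono)
    finally have "vector_maximal q f x epowr p \<le> (SUP N. U N x) epowr (p / q)"
      unfolding vector_maximal_def epowr_epowr using pq by (auto intro!: epowr_mono)
    also have "\<dots> = (SUP N. U N x epowr (p / q))" by (rule SUP_epowr[OF pq])
    finally have "vector_maximal q f x epowr p * w x \<le> (SUP N. U N x epowr (p / q)) * w x"
      by (rule mult_right_mono) simp
    also have "\<dots> = (SUP N. U N x epowr (p / q) * w x)" by (rule SUP_mult_right_ennreal)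
    also have "\<dots> \<le> liminf (\<lambda>N. majorant N F x)"
    proof (rule SUP_least)
      fix N
      have "U N x epowr (p / q) * w x \<le> majorant N' F x" if "N \<le> N'" for N'
        using U_mono[OF that, of x] W(2)[of N' x] pq
        by (meson epowr_mono less_imp_le mult_right_mono order_trans zero_le)
      then show "U N x epowr (p / q) * w x \<le> liminf (\<lambda>N. majorant N F x)"
        by (intro Liminf_bounded) (auto simp: eventually_sequentially)
    qed
    finally show ?thesis .
  qed
  then have "(\<integral>\<^sup>+x. vector_maximal q f x epowr p * w x \<partial>lebesgue) \<le> (\<integral>\<^sup>+x. liminf (\<lambda>N. majorant N F x) \<partial>lebesgue)"
    by (rule nn_integral_mono)
  also have "\<dots> \<le> liminf (\<lambda>N. \<integral>\<^sup>+x. majorant N F x \<partial>lebesgue)"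
    by (rule nn_integral_liminf[OF W(1)])
  also have "\<dots> \<le> ?R"
    using Liminf_mono[of "\<lambda>N. \<integral>\<^sup>+x. majorant N F x \<partial>lebesgue" "\<lambda>_. ?R" sequentially] W(3)
    by (simp add: Liminf_const)
  finally show ?thesis .
qed

end

section \<open>Arbitrary weights and the theorem\<close>

lemma locally_integrable_measurable:
  fixes u :: "real ^ 'n \<Rightarrow> real"
  assumes "locally_integrable u"
  shows "u \<in> borel_measurable lebesgue"
proof (rule borel_measurable_LIMSEQ_real)
  fix j :: nat
  have "set_integrable lebesgue (cball 0 (real j)) u"
    using assms by (auto simp: locally_integrable_def)
  then show "(\<lambda>x. indicator (cball 0 (real j)) x *\<^sub>R u x) \<in> borel_measurable lebesgue"
    unfolding set_integrable_def by (rule borel_measurable_integrable)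
next
  fix x :: "real ^ 'n"
  obtain j0 where "norm x \<le> real j0" using real_arch_simple by blast
  then have "eventually (\<lambda>j. indicator (cball 0 (real j)) x *\<^sub>R u x = u x) sequentially"
    by (auto simp: eventually_sequentially indicator_def intro!: exI[of _ j0])
  then show "(\<lambda>j. indicator (cball 0 (real j)) x *\<^sub>R u x) \<longlonglongrightarrow> u x"
    by (rule tendsto_eventually)
qed

lemma cube_emeasure: 
  fixes Q :: "(real ^ 'n) set"
  assumes "Q \<in> cubes"
  shows "0 < emeasure lebesgue Q" "emeasure lebesgue Q < top" "Q \<in> sets lebesgue" "compact Q"
proof -
  obtain a l where Q: "Q = closed_cube a l" "0 < l" using assms by (auto simp: cubes_eq)
  show "0 < emeasure lebesgue Q" "emeasure lebesgue Q < top"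
    using Q by (simp_all add: emeasure_closed_cube del: emeasure_completion)
  show "Q \<in> sets lebesgue" using Q by simp
  show "compact Q" using Q by (simp add: closed_cube_def)
qed

lemma average_finite:
  assumes "Q \<in> cubes" "weight w"
  shows "average Q (\<lambda>x. ennreal (w x)) < top"
proof -
  have "set_integrable lebesgue Q w"
    using assms cube_emeasure(4) by (auto simp: weight_def locally_integrable_def)
  then have "(\<integral>\<^sup>+x. ennreal (norm (indicator Q x *\<^sub>R w x)) \<partial>lebesgue) < top"
    unfolding set_integrable_def by (simp add: integrable_iff_bounded)
  also have "(\<integral>\<^sup>+x. ennreal (norm (indicator Q x *\<^sub>R w x)) \<partial>lebesgue) = (\<integral>\<^sup>+x\<in>Q. ennreal (w x) \<partial>lebesgue)"
    using assms(2) by (intro nn_integral_cong) (auto simp: indicator_def weight_def)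
  finally show ?thesis
    unfolding average_def using cube_emeasure(1)[OF assms(1)]
    by (auto simp: ennreal_divide_eq_top_iff less_top[symmetric] zero_less_iff_neq_zero)
qed

lemma average_eq_0_AE:
  assumes Q: "Q \<in> cubes" and [measurable]: "h \<in> borel_measurable lebesgue" and "average Q h = 0"
  shows "AE x in lebesgue. x \<in> Q \<longrightarrow> h x = 0"
proof -
  have [measurable]: "Q \<in> sets lebesgue" by (rule cube_emeasure(3)[OF Q])
  have "(\<integral>\<^sup>+x\<in>Q. h x \<partial>lebesgue) = 0"
    using assms(3) cube_emeasure(2)[OF Q] by (auto simp: average_def ennreal_divide_eq_0_iff less_top[symmetric])
  then have "AE x in lebesgue. h x * indicator Q x = 0"
    by (subst (asm) nn_integral_0_iff_AE) auto
  then show ?thesis by eventually_elim (auto simp: indicator_def)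
qed

lemma average_finite_AE:
  assumes Q: "Q \<in> cubes" and [measurable]: "h \<in> borel_measurable lebesgue" and fin: "average Q h < top"
  shows "AE x in lebesgue. x \<in> Q \<longrightarrow> h x \<noteq> top"
proof -
  have [measurable]: "Q \<in> sets lebesgue" by (rule cube_emeasure(3)[OF Q])
  have "(\<integral>\<^sup>+x\<in>Q. h x \<partial>lebesgue) \<noteq> \<infinity>"
    using fin cube_emeasure(2)[OF Q] by (auto simp: average_def ennreal_top_divide less_top[symmetric])
  then have "AE x in lebesgue. h x * indicator Q x \<noteq> \<infinity>"
    by (intro nn_integral_PInf_AE) auto
  then show ?thesis by eventually_elim (auto simp: indicator_def)
qed

lemma cube_not_AE:
  assumes Q: "Q \<in> cubes" shows "\<not> (AE x in lebesgue. x \<notin> Q)"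
proof
  assume "AE x in lebesgue. x \<notin> Q"
  then have "emeasure lebesgue Q = 0"
    using cube_emeasure(3)[OF Q] AE_iff_null[of lebesgue "\<lambda>x. x \<notin> Q"]
    by (auto simp: null_sets_def simp del: emeasure_completion)
  then show False using cube_emeasure(1)[OF Q] by simp
qed

lemma average_cong_AE:
  "AE x in lebesgue. h x = h' x \<Longrightarrow> average Q h = average Q h'"
  unfolding average_def by (intro arg_cong2[where f = "(/)"] nn_integral_cong_AE refl) (auto elim: eventually_mono)

text \<open>If the average of the dual weight were infinite, \<open>A\<^sub>p\<close> would be infinite on this cube. The \<open>A\<^sub>r\<close> factor cannot
  compensate for this: it is not zero, because \<open>w\<close> is finite and so its negative powers are positive.\<close>

lemma average_dual_finite:
  fixes w :: "real ^ 'n \<Rightarrow> real"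
  assumes w: "weight w" and pr: "1 < p" "1 < r" and ab: "0 < \<alpha>" "0 < \<beta>"
    and fin: "mixed_Ap_Ar p \<alpha> r \<beta> w < top" and Q: "Q \<in> cubes"
    and pos: "average Q (\<lambda>x. ennreal (w x)) \<noteq> 0"
  shows "average Q (\<lambda>x. ennreal (w x) epowr (- 1 / (p - 1))) < top"
proof (rule ccontr)
  have [measurable]: "w \<in> borel_measurable lebesgue"
    using w by (auto simp: weight_def intro: locally_integrable_measurable)
  assume "\<not> ?thesis"
  then have "Ap_cube p w Q epowr \<alpha> = top"
    using pr ab pos by (simp add: Ap_cube_def less_top[symmetric] ennreal_mult_top)
  moreover have "average Q (\<lambda>x. ennreal (w x) epowr (- 1 / (r - 1))) \<noteq> 0"
  proof
    assume "average Q (\<lambda>x. ennreal (w x) epowr (- 1 / (r - 1))) = 0"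
    then have "AE x in lebesgue. x \<in> Q \<longrightarrow> ennreal (w x) epowr (- 1 / (r - 1)) = 0"
      by (rule average_eq_0_AE[OF Q, rotated]) measurable
    then have "AE x in lebesgue. x \<notin> Q"
    proof eventually_elim
      case (elim x)
      have "ennreal (w x) epowr (- 1 / (r - 1)) \<noteq> 0"
        using pr by (cases "w x > 0") (auto simp: epowr_ennreal ennreal_neg epowr_def)
      with elim show ?case by auto
    qed
    with cube_not_AE[OF Q] show False by simp
  qed
  then have "Ap_cube r w Q epowr \<beta> \<noteq> 0"
    using pr ab pos by (simp add: Ap_cube_def epowr_pos_iff)
  ultimately have "Ap_cube p w Q epowr \<alpha> * Ap_cube r w Q epowr \<beta> = top"
    by (simp add: ennreal_top_mult)
  moreover have "Ap_cube p w Q epowr \<alpha> * Ap_cube r w Q epowr \<beta> \<le> mixed_Ap_Ar p \<alpha> r \<beta> w"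
    unfolding mixed_Ap_Ar_def by (rule SUP_upper[OF Q])
  ultimately show False using fin by (simp add: top_unique)
qed

text \<open>On a cube where \<open>w\<close> is not almost everywhere zero, the dual weight has finite average, so \<open>w\<close> is positive almost
  everywhere there; enlarge the cube.\<close>

lemma weight_zero_or_positive_AE:
  fixes w :: "real ^ 'n \<Rightarrow> real"
  assumes w: "weight w" and pr: "1 < p" "1 < r" and ab: "0 < \<alpha>" "0 < \<beta>"
    and fin: "mixed_Ap_Ar p \<alpha> r \<beta> w < top"
  shows "(AE x in lebesgue. w x = 0) \<or> (AE x in lebesgue. 0 < w x)"
proof (rule disjCI)
  have wm [measurable]: "w \<in> borel_measurable lebesgue"
    using w by (auto simp: weight_def intro: locally_integrable_measurable)
  have w0: "0 \<le> w x" for x using w by (simp add: weight_def)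
  define Q :: "nat \<Rightarrow> (real ^ 'n) set" where "Q j = closed_cube (\<chi> i. - real (Suc j)) (2 * real (Suc j))" for j
  have Q: "Q j \<in> cubes" for j unfolding Q_def cubes_eq by (auto intro!: exI[of _ "2 * real (Suc j)"])
  have Q_mono: "Q i \<subseteq> Q j" if "i \<le> j" for i j
  proof
    fix x assume "x \<in> Q i"
    then have "- real (Suc i) \<le> x $ m \<and> x $ m \<le> real (Suc i)" for m
      by (simp add: Q_def mem_closed_cube)
    moreover have "real (Suc i) \<le> real (Suc j)" using that by simp
    ultimately have "- real (Suc j) \<le> x $ m \<and> x $ m \<le> real (Suc j)" for m
      by (meson le_minus_iff minus_le_iff order_trans)
    then show "x \<in> Q j" by (simp add: Q_def mem_closed_cube)
  qed
  have Q_UN: "\<exists>j. x \<in> Q j" for x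
  proof -
    obtain j where j: "norm x \<le> real j" using real_arch_simple by blast
    have "- real (Suc j) \<le> x $ i \<and> x $ i \<le> - real (Suc j) + 2 * real (Suc j)" for i
    proof -
      have "\<bar>x $ i\<bar> \<le> real j" using component_le_norm_cart[of x i] j by linarith
      then have "- real j \<le> x $ i" "x $ i \<le> real j" by linarith+
      then show ?thesis by simp
    qed
    then have "x \<in> Q j" by (simp add: Q_def mem_closed_cube)
    then show ?thesis by blast
  qed
  assume "\<not> (AE x in lebesgue. 0 < w x)"
  have "AE x in lebesgue. x \<in> Q i \<longrightarrow> w x = 0" for i
  proof (rule ccontr)
    assume i: "\<not> ?thesis"
    have "AE x in lebesgue. x \<in> Q j \<longrightarrow> 0 < w x" if ij: "i \<le> j" for j
    proof -
      have "average (Q j) (\<lambda>x. ennreal (w x)) \<noteq> 0"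
      proof
        assume "average (Q j) (\<lambda>x. ennreal (w x)) = 0"
        then have "AE x in lebesgue. x \<in> Q j \<longrightarrow> ennreal (w x) = 0"
          by (rule average_eq_0_AE[OF Q, rotated]) measurable
        then have "AE x in lebesgue. x \<in> Q i \<longrightarrow> w x = 0"
          by eventually_elim (use Q_mono[OF ij] w0 in \<open>auto simp: ennreal_eq_0_iff antisym\<close>)
        with i show False by simp
      qed
      then have "average (Q j) (\<lambda>x. ennreal (w x) epowr (- 1 / (p - 1))) < top"
        by (rule average_dual_finite[OF w pr ab fin Q])
      then have "AE x in lebesgue. x \<in> Q j \<longrightarrow> ennreal (w x) epowr (- 1 / (p - 1)) \<noteq> top"
        by (rule average_finite_AE[OF Q, rotated]) measurable
      then show ?thesis
      proof eventually_elim
        case (elim x)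
        show ?case
        proof
          assume "x \<in> Q j"
          with elim have "w x \<noteq> 0" using pr by (auto simp: epowr_def)
          with w0[of x] show "0 < w x" by simp
        qed
      qed
    qed
    then have "AE x in lebesgue. \<forall>j. i \<le> j \<longrightarrow> x \<in> Q j \<longrightarrow> 0 < w x"
      by (simp add: AE_all_countable)
    then have "AE x in lebesgue. 0 < w x"
    proof eventually_elim
      case (elim x)
      obtain j where "x \<in> Q j" using Q_UN by blast
      then have "x \<in> Q (max i j)" using Q_mono[of j "max i j"] by auto
      with elim show ?case by (meson max.cobounded1)
    qed
    with \<open>\<not> (AE x in lebesgue. 0 < w x)\<close> show False by simp
  qed
  then have "AE x in lebesgue. \<forall>i. x \<in> Q i \<longrightarrow> w x = 0" by (subst AE_all_countable) blast
  then show "AE x in lebesgue. w x = 0" by eventually_elim (use Q_UN in blast)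
qed

lemma weighted_bound:
  fixes w :: "real ^ 'n \<Rightarrow> real" and f :: "nat \<Rightarrow> real ^ 'n \<Rightarrow> real"
  assumes q: "1 < q" and p: "q + 1 < p" and r: "p \<le> r"
    and w: "weight w" and f: "\<And>i. locally_integrable (f i)"
  defines "K \<equiv> mixed_Ap_Ar p (1 / (p - 1)) r (1 / q - 1 / (p - 1)) w"
  assumes fin: "K < top" and pos: "AE x in lebesgue. 0 < w x"
  shows "core_const TYPE('n) p q r < top"
    and "weighted_Lp_norm p w (vector_maximal q f)
      \<le> grid_const TYPE('n) p q epowr (1 / p) * core_const TYPE('n) p q r epowr (1 / q) * K *
        weighted_Lp_norm p w (\<lambda>x. lq_norm q (\<lambda>i. f i x))"
proof -
  have wm [measurable]: "w \<in> borel_measurable lebesgue"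
    using w by (auto simp: weight_def intro: locally_integrable_measurable)
  have ab: "0 < 1 / (p - 1)" "0 < 1 / q - 1 / (p - 1)" using p q by (auto simp: field_simps)
  have pr: "1 < p" "1 < r" using p q r by auto
  \<comment> \<open>The value \<open>1\<close> on the null set where \<open>w\<close> vanishes is an arbitrary positive number.\<close>
  define v where "v x = (if 0 < w x then ennreal (w x) else 1)" for x
  have eq: "AE x in lebesgue. ennreal (w x) = v x"
    using pos by eventually_elim (simp add: v_def)
  have avg_w: "average Q v = average Q (\<lambda>x. ennreal (w x))" for Q
    by (rule average_cong_AE) (use eq in \<open>auto elim: eventually_mono\<close>)
  have avg_dual: "average Q (\<lambda>x. v x epowr a) = average Q (\<lambda>x. ennreal (w x) epowr a)" for Q a
    by (rule average_cong_AE) (use eq in \<open>auto elim!: eventually_mono\<close>)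
  have nz: "average Q (\<lambda>x. ennreal (w x)) \<noteq> 0" if Q: "Q \<in> cubes" for Q
  proof
    assume "average Q (\<lambda>x. ennreal (w x)) = 0"
    then have "AE x in lebesgue. x \<in> Q \<longrightarrow> ennreal (w x) = 0"
      by (rule average_eq_0_AE[OF Q, rotated]) measurable
    with pos have "AE x in lebesgue. x \<notin> Q" by eventually_elim (auto simp: ennreal_eq_0_iff)
    with cube_not_AE[OF Q] show False by simp
  qed
  interpret positive_weight v p q r K
  proof
    show "v \<in> borel_measurable lebesgue" unfolding v_def by measurable
    fix Q :: "(real ^ 'n) set" assume Q: "Q \<in> cubes"
    show "average Q v < top" unfolding avg_w by (rule average_finite[OF Q w])
    show "average Q (\<lambda>y. v y epowr (- 1 / (p - 1))) < top"
      unfolding avg_dual by (rule average_dual_finite[OF w pr ab _ Q nz[OF Q]]) (use fin in \<open>simp add: K_def\<close>)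
    have "Ap_cube p w Q epowr (1 / (p - 1)) * Ap_cube r w Q epowr (1 / q - 1 / (p - 1)) \<le> K"
      unfolding K_def mixed_Ap_Ar_def by (rule SUP_upper[OF Q])
    then show "(average Q v * average Q (\<lambda>y. v y epowr (- 1 / (p - 1))) epowr (p - 1)) epowr (1 / (p - 1)) *
      (average Q v * average Q (\<lambda>y. v y epowr (- 1 / (r - 1))) epowr (r - 1)) epowr (1 / q - 1 / (p - 1)) \<le> K"
      unfolding avg_w avg_dual Ap_cube_def .
  qed (use p q pr in \<open>auto simp: v_def\<close>)
  show "core_const TYPE('n) p q r < top" by (rule core_const_finite)
  have int: "(\<integral>\<^sup>+x. F x epowr p * ennreal (w x) \<partial>lebesgue) = (\<integral>\<^sup>+x. F x epowr p * v x \<partial>lebesgue)" for F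
    by (rule nn_integral_cong_AE) (use eq in \<open>auto elim: eventually_mono\<close>)
  have p0: "0 < 1 / p" using pr by simp
  have "weighted_Lp_norm p w (vector_maximal q f)
    \<le> (grid_const TYPE('n) p q * ((core_const TYPE('n) p q r * K epowr q) epowr (p / q) *
      (\<integral>\<^sup>+x. lq_norm q (\<lambda>i. f i x) epowr p * v x \<partial>lebesgue))) epowr (1 / p)"
    unfolding weighted_Lp_norm_def int using p0
    by (intro epowr_mono maximal_bound locally_integrable_measurable f) auto
  also have "\<dots> = grid_const TYPE('n) p q epowr (1 / p) * core_const TYPE('n) p q r epowr (1 / q) * K *
        weighted_Lp_norm p w (\<lambda>x. lq_norm q (\<lambda>i. f i x))"
    unfolding weighted_Lp_norm_def int using p0 q pr
    by (simp add: epowr_mult epowr_epowr mult.assoc)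
  finally show "weighted_Lp_norm p w (vector_maximal q f)
      \<le> grid_const TYPE('n) p q epowr (1 / p) * core_const TYPE('n) p q r epowr (1 / q) * K *
        weighted_Lp_norm p w (\<lambda>x. lq_norm q (\<lambda>i. f i x))" .
qed

lemma grid_const_finite:
  fixes p q :: real
  assumes "1 < q" "0 < p"
  shows "grid_const TYPE('n::finite) p q < top"
proof -
  have pq: "0 < p / q" using assms by simp
  have "(ennreal (6 ^ CARD('n)) epowr q) epowr (p / q) < top"
    using assms pq by (intro epowr_less_top) auto
  moreover have "of_nat m epowr (p / q) * of_nat m < top" for m
    using epowr_less_top[OF pq, of "of_nat m"] by (simp add: ennreal_mult_less_top of_nat_less_top)
  ultimately show ?thesis unfolding grid_const_def by (simp only: ennreal_mult_less_top) blast
qed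

theorem mainTheorem4:
  fixes p q r :: real
  assumes "1 < q" and "q + 1 < p" and "p \<le> r"
  shows "\<exists>c::real. 0 < c \<and>
    (\<forall>(w :: real ^ 'n \<Rightarrow> real) (f :: nat \<Rightarrow> real ^ 'n \<Rightarrow> real).
       weight w \<longrightarrow> (\<forall>i. locally_integrable (f i)) \<longrightarrow>
       mixed_Ap_Ar p (1 / (p - 1)) r (1 / q - 1 / (p - 1)) w < \<infinity> \<longrightarrow>
       weighted_Lp_norm p w (vector_maximal q f)
         \<le> ennreal c * mixed_Ap_Ar p (1 / (p - 1)) r (1 / q - 1 / (p - 1)) w *
           weighted_Lp_norm p w (\<lambda>x. lq_norm q (\<lambda>i. f i x)))"
proof -
  let ?C = "grid_const TYPE('n) p q epowr (1 / p) * core_const TYPE('n) p q r epowr (1 / q)"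
  \<comment> \<open>The summand \<open>1\<close> only makes \<open>c\<close> positive. That \<open>?C\<close> is finite is known once a nonzero weight is given.\<close>
  define c where "c = enn2real ?C + 1"
  show ?thesis
  proof (intro exI[of _ c] conjI allI impI)
    show "0 < c" using enn2real_nonneg[of ?C] by (simp add: c_def add_nonneg_pos)
  next
    fix w :: "real ^ 'n \<Rightarrow> real" and f :: "nat \<Rightarrow> real ^ 'n \<Rightarrow> real"
    let ?K = "mixed_Ap_Ar p (1 / (p - 1)) r (1 / q - 1 / (p - 1)) w"
    assume w: "weight w" and f: "\<forall>i. locally_integrable (f i)" and K: "?K < \<infinity>"
    have ab: "0 < 1 / (p - 1)" "0 < 1 / q - 1 / (p - 1)" using assms by (auto simp: field_simps)
    have "(AE x in lebesgue. w x = 0) \<or> (AE x in lebesgue. 0 < w x)"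
      by (rule weight_zero_or_positive_AE[OF w _ _ ab]) (use assms K in auto)
    then show "weighted_Lp_norm p w (vector_maximal q f)
      \<le> ennreal c * ?K * weighted_Lp_norm p w (\<lambda>x. lq_norm q (\<lambda>i. f i x))"
    proof
      assume "AE x in lebesgue. w x = 0"
      \<comment> \<open>The left-hand side is \<open>0\<close>, since \<open>\<infinity> * 0 = 0\<close> where the maximal function is infinite.\<close>
      then have "(\<integral>\<^sup>+x. vector_maximal q f x epowr p * ennreal (w x) \<partial>lebesgue) = (\<integral>\<^sup>+x. 0 \<partial>(lebesgue :: (real ^ 'n) measure))"
        by (intro nn_integral_cong_AE) (auto elim: eventually_mono)
      then show ?thesis using assms by (simp add: weighted_Lp_norm_def)
    next
      assume pos: "AE x in lebesgue. 0 < w x"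
      note bound = weighted_bound[OF assms w _ _ pos, of f]
      have "core_const TYPE('n) p q r < top" using f K by (intro bound(1)) auto
      moreover have "grid_const TYPE('n) p q < top" using assms by (intro grid_const_finite) auto
      ultimately have "?C < top"
        using assms by (simp add: ennreal_mult_less_top epowr_less_top)
      then have "?C \<le> ennreal c"
        unfolding c_def by (cases ?C) (auto intro: ennreal_leI)
      moreover have "weighted_Lp_norm p w (vector_maximal q f)
          \<le> ?C * ?K * weighted_Lp_norm p w (\<lambda>x. lq_norm q (\<lambda>i. f i x))"
        using f K by (intro bound(2)) auto
      ultimately show ?thesis
        by (meson mult_right_mono order_trans zero_le)
    qed
  qed
qed

end
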